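(* Let $G$ be a nontrivial finite group, let $D$ be a set of pairwise disjoint non-empty subsets of $G$ which collectively generate $G$, each of which is a union of conjugacy classes of $G$, and let $\xi:D\to\mathbb{Z}_{>0}$ be a map. Then: (i) (affine case) $\left|\pi_0\mathrm{CHur}^*_{\mathbb{A}^1(\mathbb{C})}(G,D,n\xi)\right|=\Theta\left(n^{\Omega(D)}\right)$. (ii) (projective case) $\left|\pi_0\mathrm{CHur}^*_{\mathbb{P}^1(\mathbb{C})}(G,D,n\xi)\right|=O\left(n^{\Omega(D)}\right)$, and $n^{\Omega(D)}=O\left(\left|\pi_0\mathrm{CHur}^*_{\mathbb{P}^1(\mathbb{C})}(G,D,n\exp(G)\xi)\right|\right)$, where $\exp(G)$ denotes the exponent of $G$.
   Context: Let $c=\bigsqcup_{\gamma\in D}\gamma$ and let $D^*$ be the set of conjugacy classes of $G$ contained in $c$. The splitting number is $\Omega(D):=|D^*|-|D|$. Let $|\xi|=\sum_{\gamma\in D}\xi(\gamma)$. The Artin braid group $\mathrm{B}_m$ (generators $\sigma_1,\dots,\sigma_{m-1}$) acts on $G^m$ by $\sigma_i.(g_1,\dots,g_m)=(g_1,\dots,g_{i-1},g_ig_{i+1}g_i^{-1},g_i,g_{i+2},\dots,g_m)$. For $X\in\{\mathbb{A}^1(\mathbb{C}),\mathbb{P}^1(\mathbb{C})\}$, $\pi_0\mathrm{CHur}^*_X(G,D,n\xi)$ is the set of $\mathrm{B}_{n|\xi|}$-orbits of tuples $\underline g\in G^{n|\xi|}$ whose entries generate $G$, such that for each $\gamma\in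 D$ exactly $n\xi(\gamma)$ entries of $\underline g$ belong to $\gamma$, and, if $X=\mathbb{P}^1(\mathbb{C})$, such that $g_1\cdots g_{n|\xi|}=1$. (It indexes the connected components of a Hurwitz space of connected marked $G$-covers of $X$.) $f=\Theta(g)$ means $f=O(g)$ and $g=O(f)$, as $n\to\infty$. *)

theory Defs
  imports "HOL-Algebra.Algebra" "HOL-Library.Landau_Symbols"
begin

section \<open>The Artin braid group\<close>

text \<open>
  The braid group on \<open>m\<close> strands is the quotient of the monoid of words in the letters
  \<open>(i, s)\<close> with \<open>i + 1 < m\<close> by the congruence generated by free cancellation and the Artin
  relations.  Indices start at \<open>0\<close>: the letters \<open>(i, True)\<close> and \<open>(i, False)\<close> stand for
  \<open>\<sigma>\<close> and its inverse, where \<open>\<sigma>\<close> is the \<open>(i + 1)\<close>-st Artin generator.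
\<close>

type_synonym braid_word = "(nat \<times> bool) list"

definition braid_words :: "nat \<Rightarrow> braid_word set" where
  "braid_words m = lists ({i. Suc i < m} \<times> UNIV)"

inductive_set braid_rel :: "nat \<Rightarrow> (braid_word \<times> braid_word) set" for m :: nat where
  refl: "w \<in> braid_words m \<Longrightarrow> (w, w) \<in> braid_rel m"
| sym: "(u, v) \<in> braid_rel m \<Longrightarrow> (v, u) \<in> braid_rel m"
| trans: "(u, v) \<in> braid_rel m \<Longrightarrow> (v, w) \<in> braid_rel m \<Longrightarrow> (u, w) \<in> braid_rel m"
| cong: "(u, v) \<in> braid_rel m \<Longrightarrow> a \<in> braid_words m \<Longrightarrow> b \<in> braid_words m \<Longrightarrow>
    (a @ u @ b, a @ v @ b) \<in> braid_rel m"
| cancel: "Suc i < m \<Longrightarrow> ([(i, s), (i, \<not> s)], []) \<in> braid_rel m"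
| commute: "i + 2 \<le> j \<Longrightarrow> Suc j < m \<Longrightarrow>
    ([(i, True), (j, True)], [(j, True), (i, True)]) \<in> braid_rel m"
| braid: "Suc (Suc i) < m \<Longrightarrow>
    ([(i, True), (Suc i, True), (i, True)], [(Suc i, True), (i, True), (Suc i, True)])
      \<in> braid_rel m"

definition braid_group :: "nat \<Rightarrow> braid_word set monoid" where
  "braid_group m =
    \<lparr>carrier = braid_words m // braid_rel m,
     monoid.mult = \<lambda>A B. \<Union>u\<in>A. \<Union>v\<in>B. braid_rel m `` {u @ v},
     one = braid_rel m `` {[]}\<rparr>"

lemma braid_words_simps [simp]:
  "[] \<in> braid_words m"
  "x # w \<in> braid_words m \<longleftrightarrow> Suc (fst x) < m \<and> w \<in> braid_words m"
  "u @ v \<in> braid_words m \<longleftrightarrow> u \<in> braid_words m \<and> v \<in> braid_words m"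
  by (auto simp: braid_words_def mem_Times_iff)

lemma braid_rel_words:
  "(u, v) \<in> braid_rel m \<Longrightarrow> u \<in> braid_words m \<and> v \<in> braid_words m"
  by (induction rule: braid_rel.induct) auto

lemma equiv_braid_rel: "equiv (braid_words m) (braid_rel m)"
proof (rule equivI)
  show "braid_rel m \<subseteq> braid_words m \<times> braid_words m"
    using braid_rel_words by auto
  show "refl_on (braid_words m) (braid_rel m)"
    by (auto simp: refl_on_def braid_rel.refl)
  show "sym (braid_rel m)" by (auto intro: symI braid_rel.sym)
  show "trans (braid_rel m)" by (auto intro: transI braid_rel.trans)
qed

lemma braid_rel_append:
  assumes "(u, u') \<in> braid_rel m" "(v, v') \<in> braid_rel m"
  shows "(u @ v, u' @ v') \<in> braid_rel m"
proof -
  have "([] @ u @ v, [] @ u' @ v) \<in> braid_rel m"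
    using assms braid_rel_words by (intro braid_rel.cong) auto
  moreover have "(u' @ v @ [], u' @ v' @ []) \<in> braid_rel m"
    using assms braid_rel_words by (intro braid_rel.cong) auto
  ultimately show ?thesis by (auto intro: braid_rel.trans[of _ "u' @ v"])
qed

lemma braid_mult_class:
  assumes "u \<in> braid_words m" "v \<in> braid_words m"
  shows "braid_rel m `` {u} \<otimes>\<^bsub>braid_group m\<^esub> braid_rel m `` {v} = braid_rel m `` {u @ v}"
proof -
  have "(\<Union>u'\<in>braid_rel m `` {u}. \<Union>v'\<in>braid_rel m `` {v}. braid_rel m `` {u' @ v'})
      = braid_rel m `` {u @ v}"
  proof (rule UN_equiv_class2[OF equiv_braid_rel equiv_braid_rel _ assms])
    show "congruent2 (braid_rel m) (braid_rel m) (\<lambda>u v. braid_rel m `` {u @ v})"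
      by (rule congruent2I') (auto intro!: equiv_class_eq[OF equiv_braid_rel] braid_rel_append)
  qed
  then show ?thesis by (simp add: braid_group_def)
qed

definition braid_word_inv :: "braid_word \<Rightarrow> braid_word" where
  "braid_word_inv w = rev (map (\<lambda>(i, s). (i, \<not> s)) w)"

lemma braid_word_inv_in [simp]:
  "braid_word_inv w \<in> braid_words m \<longleftrightarrow> w \<in> braid_words m"
  by (induction w) (auto simp: braid_word_inv_def)

lemma braid_word_inv_left:
  assumes "w \<in> braid_words m"
  shows "(braid_word_inv w @ w, []) \<in> braid_rel m"
  using assms
proof (induction w)
  case Nil
  then show ?case by (simp add: braid_word_inv_def braid_rel.refl)
next
  case (Cons x w)
  obtain i s where x: "x = (i, s)" by (cases x)
  have "(braid_word_inv w @ [(i, \<not> s), (i, \<not> \<not> s)] @ w, braid_word_inv w @ [] @ w) \<in> braid_rel m"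
    using Cons.prems x by (intro braid_rel.cong braid_rel.cancel) auto
  then have "(braid_word_inv w @ [(i, \<not> s), (i, s)] @ w, []) \<in> braid_rel m"
    using Cons by (auto intro: braid_rel.trans[of _ "braid_word_inv w @ w"])
  then show ?case by (simp add: braid_word_inv_def x)
qed

lemma group_braid_group: "group (braid_group m)"
proof (rule groupI)
  have carr: "carrier (braid_group m) = (\<lambda>w. braid_rel m `` {w}) ` braid_words m"
    by (auto simp: braid_group_def quotient_def)
  have one: "\<one>\<^bsub>braid_group m\<^esub> = braid_rel m `` {[]}"
    by (simp add: braid_group_def)
  show "x \<otimes>\<^bsub>braid_group m\<^esub> y \<in> carrier (braid_group m)"
    if "x \<in> carrier (braid_group m)" "y \<in> carrier (braid_group m)" for x y
    using that by (auto simp: carr braid_mult_class)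
  show "\<one>\<^bsub>braid_group m\<^esub> \<in> carrier (braid_group m)" by (auto simp: carr one)
  show "x \<otimes>\<^bsub>braid_group m\<^esub> y \<otimes>\<^bsub>braid_group m\<^esub> z
      = x \<otimes>\<^bsub>braid_group m\<^esub> (y \<otimes>\<^bsub>braid_group m\<^esub> z)"
    if "x \<in> carrier (braid_group m)" "y \<in> carrier (braid_group m)" "z \<in> carrier (braid_group m)"
    for x y z
    using that by (auto simp: carr braid_mult_class)
  show "\<one>\<^bsub>braid_group m\<^esub> \<otimes>\<^bsub>braid_group m\<^esub> x = x" if "x \<in> carrier (braid_group m)" for x
    using that by (auto simp: carr one braid_mult_class)
  show "\<exists>y\<in>carrier (braid_group m). y \<otimes>\<^bsub>braid_group m\<^esub> x = \<one>\<^bsub>braid_group m\<^esub>"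
    if x: "x \<in> carrier (braid_group m)" for x
  proof -
    obtain w where w: "w \<in> braid_words m" "x = braid_rel m `` {w}" using x by (auto simp: carr)
    have "braid_rel m `` {braid_word_inv w} \<otimes>\<^bsub>braid_group m\<^esub> x = \<one>\<^bsub>braid_group m\<^esub>"
      using w by (simp add: braid_mult_class one equiv_class_eq[OF equiv_braid_rel] braid_word_inv_left)
    moreover have "braid_rel m `` {braid_word_inv w} \<in> carrier (braid_group m)"
      using w by (auto simp: carr)
    ultimately show ?thesis by blast
  qed
qed


section \<open>The Hurwitz action on tuples\<close>

definition tuples :: "('a, 'b) monoid_scheme \<Rightarrow> nat \<Rightarrow> 'a list set" where
  "tuples G m = {gs. length gs = m \<and> set gs \<subseteq> carrier G}"

definition hurwitz_move :: "('a, 'b) monoid_scheme \<Rightarrow> nat \<Rightarrow> 'a list \<Rightarrow> 'a list" where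
  "hurwitz_move G i gs =
    gs[i := gs ! i \<otimes>\<^bsub>G\<^esub> gs ! Suc i \<otimes>\<^bsub>G\<^esub> inv\<^bsub>G\<^esub> (gs ! i), Suc i := gs ! i]"

definition hurwitz_move_inv :: "('a, 'b) monoid_scheme \<Rightarrow> nat \<Rightarrow> 'a list \<Rightarrow> 'a list" where
  "hurwitz_move_inv G i gs =
    gs[i := gs ! Suc i, Suc i := inv\<^bsub>G\<^esub> (gs ! Suc i) \<otimes>\<^bsub>G\<^esub> gs ! i \<otimes>\<^bsub>G\<^esub> gs ! Suc i]"

definition braid_word_act :: "('a, 'b) monoid_scheme \<Rightarrow> braid_word \<Rightarrow> 'a list \<Rightarrow> 'a list" where
  "braid_word_act G =
    foldr (\<lambda>(i, s). if s then hurwitz_move G i else hurwitz_move_inv G i)"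

text \<open>
  All words in a braid act in the same way (see \<open>braid_act_class\<close> below), so \<open>the_elem\<close> is
  applied to a singleton.
\<close>

definition braid_act ::
  "('a, 'b) monoid_scheme \<Rightarrow> nat \<Rightarrow> braid_word set \<Rightarrow> 'a list \<Rightarrow> 'a list" where
  "braid_act G m B = (\<lambda>gs \<in> tuples G m. the_elem ((\<lambda>w. braid_word_act G w gs) ` B))"

lemma braid_word_act_simps [simp]:
  "braid_word_act G [] gs = gs"
  "braid_word_act G ((i, True) # w) gs = hurwitz_move G i (braid_word_act G w gs)"
  "braid_word_act G ((i, False) # w) gs = hurwitz_move_inv G i (braid_word_act G w gs)"
  "braid_word_act G (u @ v) gs = braid_word_act G u (braid_word_act G v gs)"
  by (simp_all add: braid_word_act_def)

context group
begin

lemma tuples_nth: "gs \<in> tuples G m \<Longrightarrow> i < m \<Longrightarrow> gs ! i \<in> carrier G"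
  by (auto simp: tuples_def)

lemma tuplesI: "length gs = m \<Longrightarrow> (\<And>i. i < m \<Longrightarrow> gs ! i \<in> carrier G) \<Longrightarrow> gs \<in> tuples G m"
  by (auto simp: tuples_def in_set_conv_nth)

lemma hurwitz_move_in:
  assumes "gs \<in> tuples G m" "Suc i < m"
  shows "hurwitz_move G i gs \<in> tuples G m"
proof (rule tuplesI)
  show "length (hurwitz_move G i gs) = m" using assms by (simp add: hurwitz_move_def tuples_def)
  show "hurwitz_move G i gs ! k \<in> carrier G" if "k < m" for k
    using assms that tuples_nth[OF assms(1)]
    by (auto simp: hurwitz_move_def nth_list_update tuples_def)
qed

lemma hurwitz_move_inv_in:
  assumes "gs \<in> tuples G m" "Suc i < m"
  shows "hurwitz_move_inv G i gs \<in> tuples G m"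
proof (rule tuplesI)
  show "length (hurwitz_move_inv G i gs) = m"
    using assms by (simp add: hurwitz_move_inv_def tuples_def)
  show "hurwitz_move_inv G i gs ! k \<in> carrier G" if "k < m" for k
    using assms that tuples_nth[OF assms(1)]
    by (auto simp: hurwitz_move_inv_def nth_list_update tuples_def)
qed

lemma braid_word_act_in:
  assumes "gs \<in> tuples G m" "w \<in> braid_words m"
  shows "braid_word_act G w gs \<in> tuples G m"
  using assms(2)
proof (induction w)
  case (Cons x w)
  obtain i s where "x = (i, s)" by (cases x)
  with Cons show ?case
    by (cases s) (auto intro: hurwitz_move_in hurwitz_move_inv_in)
qed (simp add: assms)

lemma conj_cancel:
  assumes "a \<in> carrier G" "b \<in> carrier G"
  shows "inv a \<otimes> (a \<otimes> b \<otimes> inv a) \<otimes> a = b" "a \<otimes> (inv a \<otimes> b \<otimes> a) \<otimes> inv a = b"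
proof -
  have "inv a \<otimes> (a \<otimes> b) = b" "a \<otimes> (inv a \<otimes> b) = b"
    using assms by (simp_all add: m_assoc[symmetric])
  then show "inv a \<otimes> (a \<otimes> b \<otimes> inv a) \<otimes> a = b" "a \<otimes> (inv a \<otimes> b \<otimes> a) \<otimes> inv a = b"
    using assms by (simp_all add: m_assoc)
qed

lemma hurwitz_move_cancel:
  assumes "gs \<in> tuples G m" "Suc i < m"
  shows "hurwitz_move_inv G i (hurwitz_move G i gs) = gs"
    and "hurwitz_move G i (hurwitz_move_inv G i gs) = gs"
proof -
  have len: "length gs = m" using assms by (simp add: tuples_def)
  have c: "gs ! i \<in> carrier G" "gs ! Suc i \<in> carrier G" using assms tuples_nth by auto
  show "hurwitz_move_inv G i (hurwitz_move G i gs) = gs"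
    using assms len c by (intro nth_equalityI)
      (auto simp: hurwitz_move_def hurwitz_move_inv_def nth_list_update conj_cancel)
  show "hurwitz_move G i (hurwitz_move_inv G i gs) = gs"
    using assms len c by (intro nth_equalityI)
      (auto simp: hurwitz_move_def hurwitz_move_inv_def nth_list_update conj_cancel)
qed

lemma hurwitz_move_commute:
  assumes "gs \<in> tuples G m" "i + 2 \<le> j" "Suc j < m"
  shows "hurwitz_move G i (hurwitz_move G j gs) = hurwitz_move G j (hurwitz_move G i gs)"
proof -
  have "length gs = m" using assms by (simp add: tuples_def)
  then show ?thesis using assms
    by (intro nth_equalityI) (auto simp: hurwitz_move_def nth_list_update)
qed

lemma hurwitz_move_braid:
  assumes "gs \<in> tuples G m" "Suc (Suc i) < m"
  shows "hurwitz_move G i (hurwitz_move G (Suc i) (hurwitz_move G i gs))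
    = hurwitz_move G (Suc i) (hurwitz_move G i (hurwitz_move G (Suc i) gs))"
proof -
  have len: "length gs = m" using assms by (simp add: tuples_def)
  have c: "gs ! i \<in> carrier G" "gs ! Suc i \<in> carrier G" "gs ! Suc (Suc i) \<in> carrier G"
    using assms tuples_nth by auto
  have "a \<otimes> b \<otimes> inv a \<otimes> (a \<otimes> c \<otimes> inv a) \<otimes> inv (a \<otimes> b \<otimes> inv a)
      = a \<otimes> (b \<otimes> c \<otimes> inv b) \<otimes> inv a"
    if abc: "a \<in> carrier G" "b \<in> carrier G" "c \<in> carrier G" for a b c
  proof -
    have "inv a \<otimes> (a \<otimes> x) = x" if "x \<in> carrier G" for x
      using abc that by (simp add: m_assoc[symmetric])
    then show ?thesis using abc by (simp add: m_assoc inv_mult_group)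
  qed
  note this[OF c]
  then show ?thesis using assms len c
    by (intro nth_equalityI) (auto simp: hurwitz_move_def nth_list_update)
qed

lemma braid_rel_act:
  assumes "(u, v) \<in> braid_rel m" "gs \<in> tuples G m"
  shows "braid_word_act G u gs = braid_word_act G v gs"
  using assms
proof (induction arbitrary: gs rule: braid_rel.induct)
  case (cong u v a b)
  then show ?case by (simp add: braid_word_act_in)
next
  case (cancel i s)
  then show ?case by (cases s) (auto simp: hurwitz_move_cancel)
next
  case (commute i j)
  then show ?case using hurwitz_move_commute[of gs m i j] by simp
next
  case (braid i)
  then show ?case using hurwitz_move_braid[of gs m i] by simp
qed simp_all

lemma braid_act_class:
  assumes "w \<in> braid_words m" "gs \<in> tuples G m"
  shows "braid_act G m (braid_rel m `` {w}) gs = braid_word_act G w gs"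
proof -
  have "braid_word_act G v gs = braid_word_act G w gs" if "v \<in> braid_rel m `` {w}" for v
    using braid_rel_act[of w v m gs] that assms(2) by simp
  moreover have "w \<in> braid_rel m `` {w}"
    using assms(1) by (simp add: braid_rel.refl)
  ultimately have "(\<lambda>v. braid_word_act G v gs) ` (braid_rel m `` {w}) = {braid_word_act G w gs}"
    by blast
  then show ?thesis using assms by (simp add: braid_act_def)
qed

lemma group_action_braid_act: "group_action (braid_group m) (tuples G m) (braid_act G m)"
proof -
  let ?B = "braid_group m" and ?T = "tuples G m" and ?f = "braid_act G m"
  have carr: "carrier ?B = (\<lambda>w. braid_rel m `` {w}) ` braid_words m"
    by (auto simp: braid_group_def quotient_def)
  have inverse: "braid_word_act G (braid_word_inv w) (braid_word_act G w gs) = gs"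
    if "w \<in> braid_words m" "gs \<in> ?T" for w gs
    using braid_rel_act[OF braid_word_inv_left[OF that(1)] that(2)] by simp
  have inv_inv: "braid_word_inv (braid_word_inv w) = w" for w
    by (induction w) (auto simp: braid_word_inv_def)
  have bij: "?f x \<in> Bij ?T" if x: "x \<in> carrier ?B" for x
  proof -
    obtain w where w: "w \<in> braid_words m" "x = braid_rel m `` {w}" using x by (auto simp: carr)
    have "bij_betw (braid_word_act G w) ?T ?T"
      using w(1) inverse[of w] inverse[of "braid_word_inv w"]
      by (intro bij_betw_byWitness[where f' = "braid_word_act G (braid_word_inv w)"])
        (auto simp: inv_inv braid_word_act_in)
    then have "bij_betw (?f x) ?T ?T"
      using w by (subst bij_betw_cong[where g = "braid_word_act G w"]) (auto simp: braid_act_class)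
    then show ?thesis by (simp add: Bij_def braid_act_def)
  qed
  have "?f (x \<otimes>\<^bsub>?B\<^esub> y) = ?f x \<otimes>\<^bsub>BijGroup ?T\<^esub> ?f y"
    if xy: "x \<in> carrier ?B" "y \<in> carrier ?B" for x y
  proof -
    obtain u v where uv: "u \<in> braid_words m" "x = braid_rel m `` {u}"
        "v \<in> braid_words m" "y = braid_rel m `` {v}"
      using xy by (auto simp: carr)
    have "?f (x \<otimes>\<^bsub>?B\<^esub> y) = compose ?T (?f x) (?f y)"
    proof (rule extensionalityI[where A = ?T])
      show "?f (x \<otimes>\<^bsub>?B\<^esub> y) gs = compose ?T (?f x) (?f y) gs" if "gs \<in> ?T" for gs
        using uv that by (simp add: braid_mult_class braid_act_class braid_word_act_in compose_def)
    qed (auto simp: braid_act_def)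
    then show ?thesis using bij xy by (simp add: BijGroup_def)
  qed
  then have "?f \<in> hom ?B (BijGroup ?T)"
    using bij by (auto simp: hom_def BijGroup_def)
  then show ?thesis
    by (simp add: group_action_def group_hom_def group_hom_axioms_def
        group_braid_group group_BijGroup)
qed

end


section \<open>Components of Hurwitz spaces and the splitting number\<close>

datatype base_curve = Affine_Line | Projective_Line

definition hurwitz_tuples ::
  "base_curve \<Rightarrow> ('a, 'b) monoid_scheme \<Rightarrow> 'a set set \<Rightarrow> ('a set \<Rightarrow> nat) \<Rightarrow> 'a list set" where
  "hurwitz_tuples curve G D \<xi> =
    {gs \<in> tuples G (\<Sum>\<gamma>\<in>D. \<xi> \<gamma>).
       generate G (set gs) = carrier G \<and>
       (\<forall>\<gamma>\<in>D. card {i. i < length gs \<and> gs ! i \<in> \<gamma>} = \<xi> \<gamma>) \<and>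
       (curve = Projective_Line \<longrightarrow> foldr (\<otimes>\<^bsub>G\<^esub>) gs \<one>\<^bsub>G\<^esub> = \<one>\<^bsub>G\<^esub>)}"

definition pi0_CHur ::
  "base_curve \<Rightarrow> ('a, 'b) monoid_scheme \<Rightarrow> 'a set set \<Rightarrow> ('a set \<Rightarrow> nat) \<Rightarrow> 'a list set set" where
  "pi0_CHur curve G D \<xi> =
    (let m = (\<Sum>\<gamma>\<in>D. \<xi> \<gamma>)
     in orbits (braid_group m) (hurwitz_tuples curve G D \<xi>) (braid_act G m))"

definition conjugacy_classes :: "('a, 'b) monoid_scheme \<Rightarrow> 'a set set" where
  "conjugacy_classes G =
    orbits G (carrier G) (\<lambda>g. \<lambda>h \<in> carrier G. g \<otimes>\<^bsub>G\<^esub> h \<otimes>\<^bsub>G\<^esub> inv\<^bsub>G\<^esub> g)"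

definition splitting_number :: "('a, 'b) monoid_scheme \<Rightarrow> 'a set set \<Rightarrow> int" where
  "splitting_number G D = int (card {\<kappa> \<in> conjugacy_classes G. \<kappa> \<subseteq> \<Union>D}) - int (card D)"

definition group_exponent :: "('a, 'b) monoid_scheme \<Rightarrow> nat" where
  "group_exponent G = (LEAST e. 0 < e \<and> (\<forall>g\<in>carrier G. g [^]\<^bsub>G\<^esub> e = \<one>\<^bsub>G\<^esub>))"

end

theory Submission
  imports Defs
begin

text \<open>
  Write \<open>c\<close> for the union of \<open>D\<close> and \<open>D\<^sup>*\<close> for the set of conjugacy classes contained
  in \<open>c\<close>.  A Hurwitz move replaces an entry by a conjugate, so the number of entries of a tuple
  in a class \<open>\<kappa>\<close> is constant on braid orbits.  The numbers attached to the classes inside one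
  \<open>\<gamma> \<in> D\<close> add up to \<open>n * \<xi> \<gamma>\<close>, which leaves \<open>|D\<^sup>*| - |D|\<close> of them free, each
  of size at most linear in \<open>n\<close>; this is where the exponent \<open>\<Omega>(D)\<close> comes from
  (lemmas \<open>card_fibre_sums_le\<close> and \<open>card_fibre_sums_ge\<close>).

  For the lower bound it is enough to realise many of these vectors of numbers by generating tuples.
  A tuple that contains every element of \<open>c\<close> generates \<open>G\<close>, and further copies of chosen
  representatives of the classes can be appended at will.  If every element occurs in runs whose
  length is a multiple of the exponent of \<open>G\<close>, the product of the tuple is trivial; this
  accounts for the factor \<open>exp(G)\<close> in the projective case (lemma \<open>card_pi0_CHur_ge\<close>).

  For the upper bound it must be shown that only boundedly many orbits share the same numbers.  Let
  \<open>e > 0\<close> be a multiple of the exponent.  A tuple with more than \<open>e * |G|\<close> entries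
  contains some \<open>h\<close> more than \<open>e\<close> times; \<open>e\<close> copies can be moved to the front while
  one copy stays behind, so that the other entries still generate \<open>G\<close>.  The block of \<open>e\<close>
  copies has trivial product, hence commutes with everything under the braid action, and moving an
  entry \<open>x\<close> across it conjugates it by \<open>x\<close>.  As the other entries generate \<open>G\<close>,
  the block may be replaced by copies of a fixed representative of the class of \<open>h\<close>
  (lemma \<open>conjugate_power_block\<close>).  Repeating this leaves blocks of representatives
  followed by one of finitely many short tuples (lemma \<open>power_block_normal_form\<close>).  The short
  tuple and the numbers of blocks determine the orbit.
\<close>

section \<open>Natural vectors with prescribed fibre sums\<close>

text \<open>
  \<open>inv_into I p\<close> chooses one index in each fibre of \<open>p\<close>; the chosen index is split off.
\<close>

lemma fibre_sum_split:
  fixes a :: "'i \<Rightarrow> nat"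
  assumes "finite I" "p ` I = J" "j \<in> J"
  defines "R \<equiv> inv_into I p ` J"
  shows "(\<Sum>i | i \<in> I \<and> p i = j. a i)
    = a (inv_into I p j) + (\<Sum>i | i \<in> I - R \<and> p i = j. a i)"
proof -
  have r: "inv_into I p j \<in> I" "p (inv_into I p j) = j"
    using assms(2,3) by (auto simp: inv_into_into f_inv_into_f)
  have "{i. i \<in> I \<and> p i = j} = insert (inv_into I p j) {i. i \<in> I - R \<and> p i = j}"
    using assms(2,3) r by (auto simp: R_def f_inv_into_f)
  moreover have "inv_into I p j \<notin> {i. i \<in> I - R \<and> p i = j}"
    using assms(3) by (auto simp: R_def)
  ultimately show ?thesis using assms(1) by simp
qed

lemma card_section:
  assumes "finite I" "p ` I = J"
  shows "card (I - inv_into I p ` J) = card I - card J"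
proof -
  have "inj_on (inv_into I p) J" using assms(2) by (auto intro: inj_on_inv_into)
  then have "card (inv_into I p ` J) = card J" by (rule card_image)
  moreover have "inv_into I p ` J \<subseteq> I" using assms(2) by (auto intro: inv_into_into)
  ultimately show ?thesis using assms(1) by (simp add: card_Diff_subset finite_subset)
qed

text \<open>
  The sum over a fibre expresses the entry at the
  chosen index by the other entries, so the entries at the \<open>card I - card J\<close> indices that
  were not chosen determine the vector.
\<close>

lemma card_fibre_sums_le:
  fixes s :: "'j \<Rightarrow> nat"
  assumes I: "finite I" and p: "p ` I = J"
  shows "card {a \<in> I \<rightarrow>\<^sub>E {..N}. \<forall>j\<in>J. (\<Sum>i | i \<in> I \<and> p i = j. a i) = s j}
    \<le> (N + 1) ^ (card I - card J)"
proof -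
  let ?R = "inv_into I p ` J"
  let ?A = "{a \<in> I \<rightarrow>\<^sub>E {..N}. \<forall>j\<in>J. (\<Sum>i | i \<in> I \<and> p i = j. a i) = s j}"
  have "inj_on (\<lambda>a. restrict a (I - ?R)) ?A"
  proof (rule inj_onI)
    fix a b assume ab: "a \<in> ?A" "b \<in> ?A" and eq: "restrict a (I - ?R) = restrict b (I - ?R)"
    have off: "a i = b i" if "i \<in> I - ?R" for i using fun_cong[OF eq, of i] that by simp
    have on: "a (inv_into I p j) = b (inv_into I p j)" if j: "j \<in> J" for j
    proof -
      have "(\<Sum>i | i \<in> I - ?R \<and> p i = j. a i) = (\<Sum>i | i \<in> I - ?R \<and> p i = j. b i)"
        using off by (intro sum.cong) auto
      moreover have "(\<Sum>i | i \<in> I \<and> p i = j. a i) = (\<Sum>i | i \<in> I \<and> p i = j. b i)"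
        using ab j by simp
      ultimately show ?thesis using fibre_sum_split[OF I p j, of a] fibre_sum_split[OF I p j, of b]
        by simp
    qed
    show "a = b"
    proof (rule PiE_ext)
      show "a \<in> I \<rightarrow>\<^sub>E {..N}" "b \<in> I \<rightarrow>\<^sub>E {..N}" using ab by auto
      show "a i = b i" if "i \<in> I" for i
      proof (cases "i \<in> ?R")
        case True
        then show ?thesis using on by blast
      next
        case False
        then show ?thesis using off that by blast
      qed
    qed
  qed
  moreover have "(\<lambda>a. restrict a (I - ?R)) ` ?A \<subseteq> (I - ?R) \<rightarrow>\<^sub>E {..N}"
    by (rule image_subsetI) (auto simp: restrict_PiE_iff PiE_iff)
  moreover have "finite ((I - ?R) \<rightarrow>\<^sub>E {..N})" using I by (intro finite_PiE) auto
  ultimately have "card ?A \<le> card ((I - ?R) \<rightarrow>\<^sub>E {..N})" by (rule card_inj_on_le)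
  also have "\<dots> = (N + 1) ^ (card I - card J)"
    using I by (simp add: card_PiE card_section[OF I p])
  finally show ?thesis .
qed

text \<open>
  Conversely, entries at most \<open>B\<close> may be prescribed freely at the indices that were not chosen:
  their sum over a fibre does not exceed \<open>s j\<close>, and the entry at the chosen index makes up the
  difference.
\<close>

lemma card_fibre_sums_ge:
  fixes s :: "'j \<Rightarrow> nat"
  assumes I: "finite I" and p: "p ` I = J"
    and B: "\<And>j. j \<in> J \<Longrightarrow> card I * B \<le> s j" and N: "\<And>j. j \<in> J \<Longrightarrow> s j \<le> N"
  shows "(B + 1) ^ (card I - card J)
    \<le> card {a \<in> I \<rightarrow>\<^sub>E {..N}. \<forall>j\<in>J. (\<Sum>i | i \<in> I \<and> p i = j. a i) = s j}"
proof -
  let ?R = "inv_into I p ` J"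
  let ?A = "{a \<in> I \<rightarrow>\<^sub>E {..N}. \<forall>j\<in>J. (\<Sum>i | i \<in> I \<and> p i = j. a i) = s j}"
  define f where "f b = (\<lambda>i\<in>I. if i \<in> ?R then s (p i) - (\<Sum>k | k \<in> I - ?R \<and> p k = p i. b k) else b i)"
    for b
  have f_off: "f b i = b i" if "i \<in> I - ?R" for b i using that by (simp add: f_def)
  have f_on: "f b i = s (p i) - (\<Sum>k | k \<in> I - ?R \<and> p k = p i. b k)" if "i \<in> ?R" "i \<in> I" for b i
    using that by (simp add: f_def)
  have "inj_on f ((I - ?R) \<rightarrow>\<^sub>E {..B})"
  proof (rule inj_onI)
    fix b c assume bc: "b \<in> (I - ?R) \<rightarrow>\<^sub>E {..B}" "c \<in> (I - ?R) \<rightarrow>\<^sub>E {..B}" and eq: "f b = f c"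
    show "b = c"
    proof (rule PiE_ext[OF bc])
      fix i assume "i \<in> I - ?R"
      then show "b i = c i" using fun_cong[OF eq, of i] f_off by simp
    qed
  qed
  moreover have "f ` ((I - ?R) \<rightarrow>\<^sub>E {..B}) \<subseteq> ?A"
  proof (rule image_subsetI)
    fix b assume b: "b \<in> (I - ?R) \<rightarrow>\<^sub>E {..B}"
    have le: "(\<Sum>k | k \<in> I - ?R \<and> p k = j. b k) \<le> s j" if j: "j \<in> J" for j
    proof -
      have "(\<Sum>k | k \<in> I - ?R \<and> p k = j. b k) \<le> (\<Sum>k | k \<in> I - ?R \<and> p k = j. B)"
        using b by (intro sum_mono) (auto simp: PiE_iff)
      also have "\<dots> \<le> card I * B" using I by (auto intro!: card_mono)
      finally show ?thesis using B[OF j] by simp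
    qed
    have "(\<Sum>i | i \<in> I \<and> p i = j. f b i) = s j" if j: "j \<in> J" for j
    proof -
      have r: "inv_into I p j \<in> I" "p (inv_into I p j) = j"
        using p j by (auto simp: inv_into_into f_inv_into_f)
      have "(\<Sum>i | i \<in> I - ?R \<and> p i = j. f b i) = (\<Sum>i | i \<in> I - ?R \<and> p i = j. b i)"
        using f_off by (intro sum.cong) auto
      moreover have "f b (inv_into I p j) = s j - (\<Sum>k | k \<in> I - ?R \<and> p k = j. b k)"
        using f_on[of "inv_into I p j" b] r j by simp
      ultimately show ?thesis using fibre_sum_split[OF I p j, of "f b"] le[OF j] by simp
    qed
    moreover have "f b i \<le> N" if i: "i \<in> I" for i
    proof (cases "i \<in> ?R")
      case True
      have "s (p i) \<le> N" using N p i by auto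
      then show ?thesis unfolding f_on[OF True i] by linarith
    next
      case False
      have "1 * B \<le> card I * B" using i I by (intro mult_right_mono) (auto simp: Suc_le_eq card_gt_0_iff)
      moreover have "card I * B \<le> N" using B[of "p i"] N[of "p i"] p i by force
      ultimately have "B \<le> N" by linarith
      moreover have "b i \<le> B" using b i False by (auto simp: PiE_iff)
      ultimately show ?thesis using f_off[of i b] False i by simp
    qed
    moreover have "f b \<in> extensional I" by (simp add: f_def)
    ultimately show "f b \<in> ?A" by (simp add: PiE_iff)
  qed
  moreover have "finite ?A" 
    using I by (intro finite_subset[of ?A "I \<rightarrow>\<^sub>E {..N}"] finite_PiE) auto
  ultimately have "card ((I - ?R) \<rightarrow>\<^sub>E {..B}) \<le> card ?A" by (rule card_inj_on_le)
  moreover have "card ((I - ?R) \<rightarrow>\<^sub>E {..B}) = (B + 1) ^ (card I - card J)"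
    using I by (simp add: card_PiE card_section[OF I p])
  ultimately show ?thesis by simp
qed


section \<open>Hurwitz equivalence\<close>

context group
begin

lemma prod_list_closed:
  "set xs \<subseteq> carrier G \<Longrightarrow> foldr (\<otimes>) xs \<one> \<in> carrier G"
  by (induction xs) auto

lemma prod_list_append:
  "set xs \<subseteq> carrier G \<Longrightarrow> set ys \<subseteq> carrier G \<Longrightarrow>
    foldr (\<otimes>) (xs @ ys) \<one> = foldr (\<otimes>) xs \<one> \<otimes> foldr (\<otimes>) ys \<one>"
  by (induction xs) (simp_all add: prod_list_closed m_assoc del: foldr_append)

lemma prod_list_replicate:
  "x \<in> carrier G \<Longrightarrow> foldr (\<otimes>) (replicate k x) \<one> = x [^] k"
  by (induction k) (simp_all only: replicate.simps foldr_Cons foldr_Nil comp_apply id_apply nat_pow_0 nat_pow_Suc2)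

text \<open>
  The relation of lying in one braid orbit, generated by the elementary moves inside a list;
  in this form it is visibly compatible with concatenation.
\<close>

inductive hurwitz_equiv :: "'a list \<Rightarrow> 'a list \<Rightarrow> bool" (infix \<open>\<asymp>\<close> 50) where
  refl: "set xs \<subseteq> carrier G \<Longrightarrow> xs \<asymp> xs"
| move: "set (us @ a # b # vs) \<subseteq> carrier G \<Longrightarrow>
    us @ a # b # vs \<asymp> us @ (a \<otimes> b \<otimes> inv a) # a # vs"
| sym: "xs \<asymp> ys \<Longrightarrow> ys \<asymp> xs"
| trans [trans]: "xs \<asymp> ys \<Longrightarrow> ys \<asymp> zs \<Longrightarrow> xs \<asymp> zs"

lemma hurwitz_equiv_carrier:
  "xs \<asymp> ys \<Longrightarrow> set xs \<subseteq> carrier G \<and> set ys \<subseteq> carrier G \<and> length xs = length ys"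
  by (induction rule: hurwitz_equiv.induct) auto

lemma hurwitz_equiv_context:
  "xs \<asymp> ys \<Longrightarrow> set us \<subseteq> carrier G \<Longrightarrow> set vs \<subseteq> carrier G \<Longrightarrow> us @ xs @ vs \<asymp> us @ ys @ vs"
proof (induction rule: hurwitz_equiv.induct)
  case (move us' a b vs')
  then show ?case using hurwitz_equiv.move[of "us @ us'" a b "vs' @ vs"] by simp
next
  case (refl xs)
  then show ?case by (intro hurwitz_equiv.refl) auto
next
  case (sym xs ys)
  then show ?case using hurwitz_equiv.sym by blast
next
  case (trans xs ys zs)
  then show ?case using hurwitz_equiv.trans by blast
qed

lemma hurwitz_equiv_append_left:
  "xs \<asymp> ys \<Longrightarrow> set us \<subseteq> carrier G \<Longrightarrow> us @ xs \<asymp> us @ ys"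
  using hurwitz_equiv_context[of xs ys us "[]"] by simp

lemma hurwitz_equiv_append_right:
  "xs \<asymp> ys \<Longrightarrow> set vs \<subseteq> carrier G \<Longrightarrow> xs @ vs \<asymp> ys @ vs"
  using hurwitz_equiv_context[of xs ys "[]" vs] by simp

lemma hurwitz_equiv_Cons:
  "xs \<asymp> ys \<Longrightarrow> u \<in> carrier G \<Longrightarrow> u # xs \<asymp> u # ys"
  using hurwitz_equiv_append_left[of xs ys "[u]"] by simp

text \<open>
  The two invariants of an orbit: conjugation changes neither the subgroup generated by the entries
  nor the number of entries in a set that is closed under conjugation.
\<close>

lemma hurwitz_equiv_generate:
  "xs \<asymp> ys \<Longrightarrow> generate G (set xs) = generate G (set ys)"
proof (induction rule: hurwitz_equiv.induct)
  case (move us a b vs)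
  let ?X = "set (us @ a # b # vs)" and ?Y = "set (us @ (a \<otimes> b \<otimes> inv a) # a # vs)"
  have X: "?X \<subseteq> carrier G" and Y: "?Y \<subseteq> carrier G" using move by auto
  note gX = generate_is_subgroup[OF X] and gY = generate_is_subgroup[OF Y]
  have "a \<in> generate G ?X" "b \<in> generate G ?X" "a \<in> generate G ?Y" "a \<otimes> b \<otimes> inv a \<in> generate G ?Y"
    by (auto intro: generate.incl)
  moreover from this have "a \<otimes> b \<otimes> inv a \<in> generate G ?X"
    using gX by (auto intro: subgroup.m_closed subgroup.m_inv_closed)
  moreover have "inv a \<otimes> (a \<otimes> b \<otimes> inv a) \<otimes> a \<in> generate G ?Y"
    using calculation gY by (auto intro: subgroup.m_closed subgroup.m_inv_closed)
  moreover have "inv a \<otimes> (a \<otimes> b \<otimes> inv a) \<otimes> a = b" using move by (intro conj_cancel) auto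
  ultimately have b: "b \<in> generate G ?Y" and c: "a \<otimes> b \<otimes> inv a \<in> generate G ?X" by simp_all
  have "?Y \<subseteq> generate G ?X"
  proof
    fix x assume "x \<in> ?Y"
    then consider "x = a \<otimes> b \<otimes> inv a" | "x \<in> ?X" by auto
    then show "x \<in> generate G ?X" using c by cases (auto intro: generate.incl)
  qed
  moreover have "?X \<subseteq> generate G ?Y"
  proof
    fix x assume "x \<in> ?X"
    then consider "x = b" | "x \<in> ?Y" by auto
    then show "x \<in> generate G ?Y" using b by cases (auto intro: generate.incl)
  qed
  ultimately have "generate G ?Y \<subseteq> generate G ?X" "generate G ?X \<subseteq> generate G ?Y"
    using generate_subgroup_incl[OF _ gX] generate_subgroup_incl[OF _ gY] by blast+
  then show ?case by blast
qed simp_all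

lemma hurwitz_equiv_count:
  assumes "xs \<asymp> ys"
    and S: "\<And>g h. g \<in> carrier G \<Longrightarrow> h \<in> carrier G \<Longrightarrow> g \<otimes> h \<otimes> inv g \<in> S \<longleftrightarrow> h \<in> S"
  shows "length (filter (\<lambda>x. x \<in> S) xs) = length (filter (\<lambda>x. x \<in> S) ys)"
  using assms(1) by (induction rule: hurwitz_equiv.induct) (simp_all add: S)

lemma hurwitz_move_append:
  "hurwitz_move G (length us) (us @ a # b # vs) = us @ (a \<otimes> b \<otimes> inv a) # a # vs"
  by (simp add: hurwitz_move_def list_update_append nth_append)

lemma hurwitz_equiv_move:
  assumes "gs \<in> tuples G m" "Suc i < m"
  shows "gs \<asymp> hurwitz_move G i gs"
proof -
  have len: "length gs = m" and carr: "set gs \<subseteq> carrier G" using assms by (auto simp: tuples_def)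
  have gs: "gs = take i gs @ gs ! i # gs ! Suc i # drop (Suc (Suc i)) gs"
    using assms len by (simp add: Cons_nth_drop_Suc)
  have take: "length (take i gs) = i" using assms len by simp
  have "set (take i gs @ gs ! i # gs ! Suc i # drop (Suc (Suc i)) gs) \<subseteq> carrier G"
    using carr by (simp only: gs[symmetric])
  note step = hurwitz_equiv.move[OF this]
  have "take i gs @ gs ! i # gs ! Suc i # drop (Suc (Suc i)) gs
      \<asymp> hurwitz_move G i (take i gs @ gs ! i # gs ! Suc i # drop (Suc (Suc i)) gs)"
    using step hurwitz_move_append[of "take i gs" "gs ! i" "gs ! Suc i" "drop (Suc (Suc i)) gs"]
    unfolding take by simp
  then show ?thesis by (simp only: gs[symmetric])
qed

lemma hurwitz_equiv_word:
  assumes "gs \<in> tuples G m" "w \<in> braid_words m"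
  shows "gs \<asymp> braid_word_act G w gs"
  using assms(2)
proof (induction w)
  case Nil
  then show ?case using assms(1) by (auto simp: tuples_def intro: hurwitz_equiv.refl)
next
  case (Cons x w)
  obtain i s where x: "x = (i, s)" by (cases x)
  let ?hs = "braid_word_act G w gs"
  have hs: "?hs \<in> tuples G m" "Suc i < m" using Cons.prems x assms by (auto intro: braid_word_act_in)
  have "?hs \<asymp> braid_word_act G (x # w) gs"
  proof (cases s)
    case True
    then show ?thesis using hurwitz_equiv_move[OF hs] x by simp
  next
    case False
    then show ?thesis
      using hurwitz_equiv_move[OF hurwitz_move_inv_in[OF hs] hs(2)] x hurwitz_move_cancel[OF hs]
      by (simp add: hurwitz_equiv.sym)
  qed
  then show ?case using Cons hurwitz_equiv.trans[of gs ?hs] by simp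
qed

lemma hurwitz_equiv_imp_word:
  "xs \<asymp> ys \<Longrightarrow> \<exists>w \<in> braid_words (length xs). braid_word_act G w xs = ys"
proof (induction rule: hurwitz_equiv.induct)
  case (refl xs)
  then show ?case by (auto intro: bexI[of _ "[]"])
next
  case (move us a b vs)
  then show ?case
    by (intro bexI[of _ "[(length us, True)]"]) (simp_all add: hurwitz_move_append)
next
  case (sym xs ys)
  then obtain w where w: "w \<in> braid_words (length xs)" "braid_word_act G w xs = ys" by blast
  have xs: "xs \<in> tuples G (length xs)" and len: "length xs = length ys"
    using hurwitz_equiv_carrier[OF sym.hyps] by (auto simp: tuples_def)
  have "braid_word_act G (braid_word_inv w) ys = xs"
    using braid_rel_act[OF braid_word_inv_left[OF w(1)] xs] w(2) by simp
  then show ?case using w(1) len by (intro bexI[of _ "braid_word_inv w"]) auto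
next
  case (trans xs ys zs)
  then obtain u v where uv: "u \<in> braid_words (length xs)" "braid_word_act G u xs = ys"
      "v \<in> braid_words (length ys)" "braid_word_act G v ys = zs" by blast
  have "length xs = length ys" using hurwitz_equiv_carrier[OF trans.hyps(1)] by simp
  then show ?case using uv by (intro bexI[of _ "v @ u"]) auto
qed

lemma braid_orbit_eq:
  assumes "gs \<in> tuples G m"
  shows "orbit (braid_group m) (braid_act G m) gs = {hs. gs \<asymp> hs}"
proof -
  have carr: "carrier (braid_group m) = (\<lambda>w. braid_rel m `` {w}) ` braid_words m"
    by (auto simp: braid_group_def quotient_def)
  have "orbit (braid_group m) (braid_act G m) gs = (\<lambda>w. braid_word_act G w gs) ` braid_words m"
  proof -
    have "orbit (braid_group m) (braid_act G m) gs = (\<lambda>x. braid_act G m x gs) ` carrier (braid_group m)"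
      by (auto simp: orbit_def)
    also have "\<dots> = (\<lambda>w. braid_word_act G w gs) ` braid_words m"
      unfolding carr image_image using assms by (intro image_cong) (simp_all add: braid_act_class)
    finally show ?thesis .
  qed
  also have "\<dots> = {hs. gs \<asymp> hs}"
    using hurwitz_equiv_word[OF assms] hurwitz_equiv_imp_word[of gs] assms
    by (fastforce simp: tuples_def)
  finally show ?thesis .
qed

lemma hurwitz_class_eq_iff:
  assumes "set gs \<subseteq> carrier G"
  shows "{ks. gs \<asymp> ks} = {ks. hs \<asymp> ks} \<longleftrightarrow> gs \<asymp> hs"
proof
  assume eq: "{ks. gs \<asymp> ks} = {ks. hs \<asymp> ks}"
  have "gs \<asymp> gs" using assms by (rule hurwitz_equiv.refl)
  then have "hs \<asymp> gs" using eq by blast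
  then show "gs \<asymp> hs" by (rule hurwitz_equiv.sym)
next
  assume "gs \<asymp> hs"
  then have "gs \<asymp> ks \<longleftrightarrow> hs \<asymp> ks" for ks
    using hurwitz_equiv.trans[of gs hs ks] hurwitz_equiv.trans[of hs gs ks] hurwitz_equiv.sym[of gs hs]
    by blast
  then show "{ks. gs \<asymp> ks} = {ks. hs \<asymp> ks}" by simp
qed


section \<open>Blocks with trivial product\<close>

text \<open>
  An entry can cross a block in two ways: it stays as it is and conjugates the block, or the
  block stays as it is and conjugates the entry by the product of the block.  If that product is
  trivial, the second way says that the block commutes with the entry.
\<close>

lemma pull_to_front:
  assumes "set ys \<subseteq> carrier G" "x \<in> carrier G"
  shows "ys @ [x] \<asymp> x # map (\<lambda>y. inv x \<otimes> y \<otimes> x) ys"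
  using assms(1)
proof (induction ys)
  case Nil
  then show ?case using assms(2) by (auto intro: hurwitz_equiv.refl)
next
  case (Cons y ys)
  let ?ys = "map (\<lambda>y. inv x \<otimes> y \<otimes> x) ys"
  have "(y # ys) @ [x] \<asymp> y # x # ?ys"
    using Cons by (auto intro: hurwitz_equiv_Cons)
  also have "y # x # ?ys \<asymp> x # (inv x \<otimes> y \<otimes> x) # ?ys"
  proof (rule hurwitz_equiv.sym)
    show "x # (inv x \<otimes> y \<otimes> x) # ?ys \<asymp> y # x # ?ys"
      using hurwitz_equiv.move[of "[]" x "inv x \<otimes> y \<otimes> x" ?ys] Cons.prems assms(2)
      by (auto simp: conj_cancel)
  qed
  finally show ?case by simp
qed

lemma pass_block:
  assumes "set B \<subseteq> carrier G" "x \<in> carrier G"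
  shows "B @ [x] \<asymp> (foldr (\<otimes>) B \<one> \<otimes> x \<otimes> inv (foldr (\<otimes>) B \<one>)) # B"
  using assms(1)
proof (induction B)
  case Nil
  then show ?case using assms(2) by (auto intro: hurwitz_equiv.refl)
next
  case (Cons b B)
  let ?P = "foldr (\<otimes>) B \<one>"
  have P: "?P \<in> carrier G" using Cons.prems by (intro prod_list_closed) simp
  have "(b # B) @ [x] \<asymp> b # (?P \<otimes> x \<otimes> inv ?P) # B"
    using Cons by (auto intro: hurwitz_equiv_Cons)
  also have "\<dots> \<asymp> (b \<otimes> (?P \<otimes> x \<otimes> inv ?P) \<otimes> inv b) # b # B"
    using hurwitz_equiv.move[of "[]" b "?P \<otimes> x \<otimes> inv ?P" B] Cons.prems assms(2) P by auto
  also have "b \<otimes> (?P \<otimes> x \<otimes> inv ?P) \<otimes> inv b = (b \<otimes> ?P) \<otimes> x \<otimes> inv (b \<otimes> ?P)"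
    using Cons.prems assms(2) P by (simp add: m_assoc inv_mult_group)
  finally show ?case by simp
qed

lemma trivial_block_commute:
  assumes "set B \<subseteq> carrier G" "foldr (\<otimes>) B \<one> = \<one>" "set us \<subseteq> carrier G"
  shows "B @ us \<asymp> us @ B"
  using assms(3)
proof (induction us)
  case Nil
  then show ?case using assms(1) by (auto intro: hurwitz_equiv.refl)
next
  case (Cons u us)
  have "B @ [u] \<asymp> u # B" using pass_block[OF assms(1), of u] assms(2) Cons.prems by simp
  then have "(B @ [u]) @ us \<asymp> (u # B) @ us"
    using Cons.prems by (intro hurwitz_equiv_append_right) auto
  also have "(u # B) @ us \<asymp> u # us @ B" using Cons by (auto intro: hurwitz_equiv_Cons)
  finally show ?case by simp
qed

text \<open>
  The block \<open>h, ..., h\<close> of length \<open>e\<close> has trivial product, so it travels freely through the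
  tuple.  Carried next to an entry \<open>x\<close> it can instead be jumped over by \<open>x\<close>, which conjugates
  it by \<open>x\<close>; carried back, it has been conjugated while the other entries are as before.
\<close>

lemma conjugate_power_block_entry:
  fixes e :: nat
  assumes e: "\<And>g. g \<in> carrier G \<Longrightarrow> g [^] e = \<one>"
    and rest: "set rest \<subseteq> carrier G" and x: "x \<in> set rest" and h: "h \<in> carrier G"
  shows "replicate e h @ rest \<asymp> replicate e (inv x \<otimes> h \<otimes> x) @ rest"
proof -
  obtain us vs where r: "rest = us @ x # vs" using x by (meson split_list)
  have c: "set us \<subseteq> carrier G" "set vs \<subseteq> carrier G" "x \<in> carrier G" using rest r by auto
  let ?B = "replicate e h" and ?C = "replicate e (inv x \<otimes> h \<otimes> x)"
  have B: "set ?B \<subseteq> carrier G" "foldr (\<otimes>) ?B \<one> = \<one>"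
    using h e by (auto simp: prod_list_replicate simp del: foldr_replicate)
  have C: "set ?C \<subseteq> carrier G" "foldr (\<otimes>) ?C \<one> = \<one>"
    using h e c(3) by (auto simp: prod_list_replicate simp del: foldr_replicate)
  have "(?B @ us) @ x # vs \<asymp> (us @ ?B) @ x # vs"
    using trivial_block_commute[OF B c(1)] c by (intro hurwitz_equiv_append_right) auto
  also have "(us @ ?B) @ x # vs = us @ (?B @ [x]) @ vs" by simp
  also have "us @ (?B @ [x]) @ vs \<asymp> us @ (x # ?C) @ vs"
    using pull_to_front[OF B(1) c(3)] c by (intro hurwitz_equiv_context) auto
  also have "us @ (x # ?C) @ vs = ((us @ [x]) @ ?C) @ vs" by simp
  also have "((us @ [x]) @ ?C) @ vs \<asymp> (?C @ us @ [x]) @ vs"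
    using trivial_block_commute[OF C, of "us @ [x]"] c
    by (intro hurwitz_equiv_append_right hurwitz_equiv.sym[of "?C @ us @ [x]"]) auto
  finally show ?thesis by (simp add: r)
qed

text \<open>
  The elements by which the block can be conjugated for every \<open>h\<close> form a subgroup, which contains
  the entries of \<open>rest\<close>.
\<close>

lemma conjugate_power_block:
  fixes e :: nat
  assumes e: "\<And>g. g \<in> carrier G \<Longrightarrow> g [^] e = \<one>"
    and rest: "set rest \<subseteq> carrier G" and g: "g \<in> generate G (set rest)" and h: "h \<in> carrier G"
  shows "replicate e h @ rest \<asymp> replicate e (inv g \<otimes> h \<otimes> g) @ rest"
  using g h
proof (induction arbitrary: h rule: generate.induct)
  case one
  then show ?case using rest by (auto intro!: hurwitz_equiv.refl)
next
  case (incl x)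
  then show ?case using conjugate_power_block_entry[OF e rest] by blast
next
  case (inv x)
  have x: "x \<in> carrier G" using inv rest by auto
  have "replicate e (x \<otimes> h \<otimes> inv x) @ rest
      \<asymp> replicate e (inv x \<otimes> (x \<otimes> h \<otimes> inv x) \<otimes> x) @ rest"
    using conjugate_power_block_entry[OF e rest inv(1)] inv(2) x by simp
  then show ?case using x inv(2) by (simp add: conj_cancel hurwitz_equiv.sym)
next
  case (eng x y)
  have xy: "x \<in> carrier G" "y \<in> carrier G"
    using eng.hyps generate_in_carrier[OF rest] by auto
  have "replicate e h @ rest \<asymp> replicate e (inv x \<otimes> h \<otimes> x) @ rest" using eng by blast
  also have "\<dots> \<asymp> replicate e (inv y \<otimes> (inv x \<otimes> h \<otimes> x) \<otimes> y) @ rest"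
    using eng xy by (intro eng.IH) auto
  also have "inv y \<otimes> (inv x \<otimes> h \<otimes> x) \<otimes> y = inv (x \<otimes> y) \<otimes> h \<otimes> (x \<otimes> y)"
    using xy eng.prems by (simp add: m_assoc inv_mult_group)
  finally show ?case .
qed

text \<open>
  Pulling a copy of \<open>h\<close> to the front conjugates the entries before it by \<open>h\<close>; for the first
  copy, all other copies lie behind it and are not affected.
\<close>

lemma gather_copies:
  assumes "set gs \<subseteq> carrier G" "k \<le> count_list gs h"
  shows "\<exists>rest. gs \<asymp> replicate k h @ rest"
  using assms
proof (induction k arbitrary: gs)
  case 0
  then show ?case by (auto intro: hurwitz_equiv.refl)
next
  case (Suc k)
  have "h \<in> set gs" using Suc.prems(2) by (metis count_list_0_iff not_less_eq_eq zero_le)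
  then obtain us vs where gs: "gs = us @ h # vs" "h \<notin> set us" by (meson split_list_first)
  have c: "set us \<subseteq> carrier G" "set vs \<subseteq> carrier G" "h \<in> carrier G" using Suc.prems gs by auto
  let ?us = "map (\<lambda>y. inv h \<otimes> y \<otimes> h) us"
  have "(us @ [h]) @ vs \<asymp> (h # ?us) @ vs"
    using c by (intro hurwitz_equiv_append_right pull_to_front) auto
  then have 1: "gs \<asymp> h # ?us @ vs" by (simp add: gs)
  have "k \<le> count_list (?us @ vs) h" using Suc.prems(2) gs by (simp add: count_notin)
  then obtain rest where "?us @ vs \<asymp> replicate k h @ rest"
    using Suc.IH[of "?us @ vs"] c by auto
  then have "h # ?us @ vs \<asymp> h # replicate k h @ rest" using c by (intro hurwitz_equiv_Cons)
  with 1 have "gs \<asymp> replicate (Suc k) h @ rest" using hurwitz_equiv.trans by simp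
  then show ?case by blast
qed

text \<open>
  One copy of \<open>h\<close> beyond the block stays behind, so that the remaining entries still generate
  the same subgroup.
\<close>

lemma split_power_block:
  assumes "set gs \<subseteq> carrier G" "e < count_list gs h"
  shows "\<exists>rest. gs \<asymp> replicate e h @ rest \<and> generate G (set rest) = generate G (set gs)"
proof -
  obtain rest where r: "gs \<asymp> replicate (Suc e) h @ rest"
    using gather_copies[of gs "Suc e" h] assms by auto
  then have "gs \<asymp> replicate e h @ h # rest" by (simp add: replicate_app_Cons_same)
  moreover have "set (replicate (Suc e) h @ rest) = set (h # rest)" by auto
  ultimately show ?thesis using hurwitz_equiv_generate[OF r] by metis
qed


section \<open>Conjugacy classes\<close>

lemma conjugacy_class_orbit:
  assumes "\<kappa> \<in> conjugacy_classes G" "h \<in> \<kappa>"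
  shows "\<kappa> = {g \<otimes> h \<otimes> inv g |g. g \<in> carrier G}" "h \<in> carrier G"
proof -
  interpret conj: group_action G "carrier G" "\<lambda>g. \<lambda>h\<in>carrier G. g \<otimes> h \<otimes> inv g"
    by (rule action_by_conjugation)
  let ?orbit = "orbit G (\<lambda>g. \<lambda>h\<in>carrier G. g \<otimes> h \<otimes> inv g)"
  show h: "h \<in> carrier G"
    using assms conj.orbits_coverture unfolding conjugacy_classes_def by blast
  have "?orbit h \<in> conjugacy_classes G" "h \<in> ?orbit h"
    using h conj.orbit_refl by (auto simp: conjugacy_classes_def orbits_def)
  then have "\<kappa> = ?orbit h"
    using conj.disjoint_union[of \<kappa> "?orbit h"] assms unfolding conjugacy_classes_def by blast
  then show "\<kappa> = {g \<otimes> h \<otimes> inv g |g. g \<in> carrier G}" using h by (simp add: orbit_def)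
qed

lemma conjugacy_class_nonempty:
  assumes "\<kappa> \<in> conjugacy_classes G" shows "\<kappa> \<noteq> {}"
  using assms by (auto simp: conjugacy_classes_def orbits_def orbit_def)

lemma ex_conjugacy_class:
  assumes "h \<in> carrier G" shows "\<exists>\<kappa> \<in> conjugacy_classes G. h \<in> \<kappa>"
  using group_action.orbits_coverture[OF action_by_conjugation] assms
  unfolding conjugacy_classes_def by blast

lemma conjugacy_class_unique:
  assumes "\<kappa> \<in> conjugacy_classes G" "\<kappa>' \<in> conjugacy_classes G" "h \<in> \<kappa>" "h \<in> \<kappa>'"
  shows "\<kappa> = \<kappa>'"
  using conjugacy_class_orbit(1)[OF assms(1,3)] conjugacy_class_orbit(1)[OF assms(2,4)] by simp

lemma conjugacy_class_closed:
  assumes \<kappa>: "\<kappa> \<in> conjugacy_classes G" and gh: "g \<in> carrier G" "h \<in> carrier G"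
  shows "g \<otimes> h \<otimes> inv g \<in> \<kappa> \<longleftrightarrow> h \<in> \<kappa>"
proof
  assume "g \<otimes> h \<otimes> inv g \<in> \<kappa>"
  then have "\<kappa> = {k \<otimes> (g \<otimes> h \<otimes> inv g) \<otimes> inv k |k. k \<in> carrier G}"
    by (rule conjugacy_class_orbit(1)[OF \<kappa>])
  moreover have "inv g \<otimes> (g \<otimes> h \<otimes> inv g) \<otimes> inv (inv g) = h" using gh by (simp add: conj_cancel)
  ultimately show "h \<in> \<kappa>" using gh by (metis (mono_tags, lifting) inv_closed mem_Collect_eq)
next
  assume "h \<in> \<kappa>"
  then show "g \<otimes> h \<otimes> inv g \<in> \<kappa>" using conjugacy_class_orbit(1)[OF \<kappa>] gh by blast
qed

end


section \<open>Block decompositions\<close>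

lemma length_filter_replicates:
  "length (filter P (concat (map (\<lambda>k. replicate (f k) (r k)) ks)))
    = (\<Sum>k\<leftarrow>ks. if P (r k) then f k else 0)"
  by (induction ks) auto

lemma (in group) prod_list_power_blocks:
  fixes e :: nat
  assumes "\<And>g. g \<in> carrier G \<Longrightarrow> g [^] e = \<one>" "r ` set ks \<subseteq> carrier G"
  shows "foldr (\<otimes>) (concat (map (\<lambda>k. replicate (e * f k) (r k)) ks)) \<one> = \<one>"
  using assms(2)
proof (induction ks)
  case (Cons k ks)
  have rk: "r k \<in> carrier G" using Cons.prems by simp
  have "foldr (\<otimes>) (replicate (e * f k) (r k)) \<one> = (r k [^] e) [^] f k"
    using rk by (simp add: prod_list_replicate nat_pow_pow del: foldr_replicate)
  also have "\<dots> = \<one>" using assms(1)[OF rk] by simp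
  finally have "foldr (\<otimes>) (replicate (e * f k) (r k)) \<one> = \<one>" .
  moreover have "set (replicate (e * f k) (r k)) \<subseteq> carrier G"
    "set (concat (map (\<lambda>k. replicate (e * f k) (r k)) ks)) \<subseteq> carrier G"
    using Cons.prems by auto
  ultimately show ?case
    using Cons by (simp add: prod_list_append del: foldr_append foldr_replicate set_concat)
qed simp

locale class_partition = group G for G (structure) +
  fixes D :: "'a set set"
  assumes finite_carrier: "finite (carrier G)"
    and part_carrier: "\<gamma> \<in> D \<Longrightarrow> \<gamma> \<subseteq> carrier G"
    and part_nonempty: "\<gamma> \<in> D \<Longrightarrow> \<gamma> \<noteq> {}"
    and parts_disjoint: "pairwise disjnt D"
    and part_union: "\<gamma> \<in> D \<Longrightarrow> \<exists>K \<subseteq> conjugacy_classes G. \<gamma> = \<Union>K"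
begin

definition part_classes :: "'a set set" where
  "part_classes = {\<kappa> \<in> conjugacy_classes G. \<kappa> \<subseteq> \<Union>D}"

definition part :: "'a set \<Rightarrow> 'a set" where
  "part \<kappa> = (THE \<gamma>. \<gamma> \<in> D \<and> \<kappa> \<subseteq> \<gamma>)"

definition rep :: "'a set \<Rightarrow> 'a" where
  "rep \<kappa> = (SOME h. h \<in> \<kappa>)"

definition class_list :: "'a set list" where
  "class_list = (SOME ks. set ks = part_classes \<and> distinct ks)"

text \<open>
  The order of the classes in \<open>class_list\<close> is arbitrary but fixed, so that the tuple depends on
  the numbers \<open>a \<kappa>\<close> only.
\<close>

definition power_blocks :: "nat \<Rightarrow> ('a set \<Rightarrow> nat) \<Rightarrow> 'a list" where
  "power_blocks e a = concat (map (\<lambda>\<kappa>. replicate (e * a \<kappa>) (rep \<kappa>)) class_list)"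

lemma Union_carrier: "\<Union>D \<subseteq> carrier G"
  using part_carrier by blast

lemma finite_parts: "finite D"
  using finite_carrier Union_carrier by (meson finite_UnionD finite_subset)

lemma part_unique: "\<gamma> \<in> D \<Longrightarrow> \<gamma>' \<in> D \<Longrightarrow> x \<in> \<gamma> \<Longrightarrow> x \<in> \<gamma>' \<Longrightarrow> \<gamma> = \<gamma>'"
  using parts_disjoint by (metis disjnt_iff pairwiseD)

lemma part_closed:
  assumes "\<gamma> \<in> D" "g \<in> carrier G" "h \<in> carrier G"
  shows "g \<otimes> h \<otimes> inv g \<in> \<gamma> \<longleftrightarrow> h \<in> \<gamma>"
proof -
  obtain K where K: "K \<subseteq> conjugacy_classes G" "\<gamma> = \<Union>K" using part_union[OF assms(1)] by blast
  then have "g \<otimes> h \<otimes> inv g \<in> \<kappa> \<longleftrightarrow> h \<in> \<kappa>" if "\<kappa> \<in> K" for \<kappa>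
    using that conjugacy_class_closed[of \<kappa> g h] assms by blast
  then show ?thesis using K(2) by blast
qed

lemma Union_closed:
  "g \<in> carrier G \<Longrightarrow> h \<in> carrier G \<Longrightarrow> g \<otimes> h \<otimes> inv g \<in> \<Union>D \<longleftrightarrow> h \<in> \<Union>D"
  by (simp add: part_closed)

lemma class_subset_part:
  assumes "\<gamma> \<in> D" "x \<in> \<gamma>" "\<kappa> \<in> conjugacy_classes G" "x \<in> \<kappa>"
  shows "\<kappa> \<subseteq> \<gamma>"
proof -
  obtain \<kappa>' where "\<kappa>' \<in> conjugacy_classes G" "x \<in> \<kappa>'" "\<kappa>' \<subseteq> \<gamma>"
    using part_union[OF assms(1)] assms(2) by blast
  moreover from this have "\<kappa> = \<kappa>'" using conjugacy_class_unique assms(3,4) by simp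
  ultimately show ?thesis by simp
qed

lemma rep_in: "\<kappa> \<in> part_classes \<Longrightarrow> rep \<kappa> \<in> \<kappa>"
  using conjugacy_class_nonempty by (auto simp: part_classes_def rep_def some_in_eq)

lemma rep_carrier: "\<kappa> \<in> part_classes \<Longrightarrow> rep \<kappa> \<in> carrier G"
  using rep_in conjugacy_class_orbit(2) by (auto simp: part_classes_def)

lemma part_eqI:
  assumes "\<kappa> \<in> part_classes" "\<gamma> \<in> D" "x \<in> \<kappa>" "x \<in> \<gamma>"
  shows "part \<kappa> = \<gamma>"
  unfolding part_def
proof (rule the_equality)
  show "\<gamma> \<in> D \<and> \<kappa> \<subseteq> \<gamma>" using assms class_subset_part by (auto simp: part_classes_def)
  show "\<gamma>' = \<gamma>" if "\<gamma>' \<in> D \<and> \<kappa> \<subseteq> \<gamma>'" for \<gamma>'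
    using that assms part_unique by blast
qed

lemma part_in: "\<kappa> \<in> part_classes \<Longrightarrow> part \<kappa> \<in> D \<and> rep \<kappa> \<in> part \<kappa>"
proof -
  assume \<kappa>: "\<kappa> \<in> part_classes"
  then obtain \<gamma> where "\<gamma> \<in> D" "rep \<kappa> \<in> \<gamma>" using rep_in[OF \<kappa>] by (auto simp: part_classes_def)
  moreover from this have "part \<kappa> = \<gamma>" using part_eqI[OF \<kappa>] rep_in[OF \<kappa>] by simp
  ultimately show ?thesis by simp
qed

lemma ex_class:
  assumes "x \<in> \<Union>D" shows "\<exists>\<kappa> \<in> part_classes. x \<in> \<kappa>"
proof -
  obtain \<gamma> where \<gamma>: "\<gamma> \<in> D" "x \<in> \<gamma>" using assms by blast
  then obtain \<kappa> where \<kappa>: "\<kappa> \<in> conjugacy_classes G" "x \<in> \<kappa>"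
    using ex_conjugacy_class part_carrier by blast
  then have "\<kappa> \<subseteq> \<gamma>" using class_subset_part \<gamma> by blast
  then show ?thesis using \<kappa> \<gamma> by (auto simp: part_classes_def)
qed

lemma part_image: "part ` part_classes = D"
proof
  show "part ` part_classes \<subseteq> D" using part_in by blast
  show "D \<subseteq> part ` part_classes"
  proof
    fix \<gamma> assume \<gamma>: "\<gamma> \<in> D"
    then obtain x where x: "x \<in> \<gamma>" using part_nonempty by blast
    then obtain \<kappa> where "\<kappa> \<in> part_classes" "x \<in> \<kappa>" using ex_class \<gamma> by blast
    then show "\<gamma> \<in> part ` part_classes" using part_eqI \<gamma> x by blast
  qed
qed

lemma rep_in_part_iff: "\<kappa> \<in> part_classes \<Longrightarrow> \<gamma> \<in> D \<Longrightarrow> rep \<kappa> \<in> \<gamma> \<longleftrightarrow> part \<kappa> = \<gamma>"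
  using part_in part_eqI rep_in by blast

lemma rep_in_class_iff: "\<kappa> \<in> part_classes \<Longrightarrow> \<kappa>' \<in> part_classes \<Longrightarrow> rep \<kappa> \<in> \<kappa>' \<longleftrightarrow> \<kappa> = \<kappa>'"
  using rep_in conjugacy_class_unique unfolding part_classes_def by blast

lemma inj_rep: "inj_on rep part_classes"
  by (rule inj_onI) (metis rep_in rep_in_class_iff)

lemma finite_part_classes: "finite part_classes"
  using inj_rep rep_carrier finite_carrier by (meson finite_imageD finite_subset image_subsetI)

lemma card_classes_le: "card part_classes \<le> card (carrier G)"
  using inj_rep rep_carrier finite_carrier by (meson card_inj_on_le image_subsetI)

lemma card_parts_le: "card D \<le> card part_classes"
  using card_image_le[OF finite_part_classes, of part] by (simp add: part_image)

lemma splitting_number_eq: "splitting_number G D = int (card part_classes - card D)"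
  using card_parts_le by (simp add: splitting_number_def part_classes_def of_nat_diff)

lemma class_list: "set class_list = part_classes" "distinct class_list"
  using someI_ex[OF finite_distinct_list[OF finite_part_classes]] by (auto simp: class_list_def)

lemma power_blocks_carrier: "set (power_blocks e a) \<subseteq> carrier G"
  using rep_carrier by (auto simp: power_blocks_def class_list)

lemma power_blocks_subset: "set (power_blocks e a) \<subseteq> \<Union>D"
  using part_in by (fastforce simp: power_blocks_def class_list)

lemma power_blocks_cong:
  "(\<And>\<kappa>. \<kappa> \<in> part_classes \<Longrightarrow> a \<kappa> = b \<kappa>) \<Longrightarrow> power_blocks e a = power_blocks e b"
  unfolding power_blocks_def by (intro arg_cong[of _ _ concat] map_cong) (auto simp: class_list)

lemma length_filter_power_blocks:
  "length (filter P (power_blocks e a)) = (\<Sum>\<kappa>\<in>part_classes. if P (rep \<kappa>) then e * a \<kappa> else 0)"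
  unfolding power_blocks_def length_filter_replicates
  by (simp add: sum_list_distinct_conv_sum_set class_list)

lemma count_part_power_blocks:
  assumes "\<gamma> \<in> D"
  shows "length (filter (\<lambda>x. x \<in> \<gamma>) (power_blocks e a))
    = e * (\<Sum>\<kappa> | \<kappa> \<in> part_classes \<and> part \<kappa> = \<gamma>. a \<kappa>)"
proof -
  have "length (filter (\<lambda>x. x \<in> \<gamma>) (power_blocks e a))
      = (\<Sum>\<kappa>\<in>part_classes. if part \<kappa> = \<gamma> then e * a \<kappa> else 0)"
    unfolding length_filter_power_blocks using assms rep_in_part_iff by (intro sum.cong) auto
  also have "\<dots> = (\<Sum>\<kappa> | \<kappa> \<in> part_classes \<and> part \<kappa> = \<gamma>. e * a \<kappa>)"
    using finite_part_classes by (simp add: sum.inter_filter)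
  finally show ?thesis by (simp add: sum_distrib_left)
qed

lemma count_class_power_blocks:
  assumes "\<kappa> \<in> part_classes"
  shows "length (filter (\<lambda>x. x \<in> \<kappa>) (power_blocks e a)) = e * a \<kappa>"
proof -
  have "length (filter (\<lambda>x. x \<in> \<kappa>) (power_blocks e a))
      = (\<Sum>\<kappa>'\<in>part_classes. if \<kappa>' = \<kappa> then e * a \<kappa>' else 0)"
    unfolding length_filter_power_blocks using assms rep_in_class_iff by (intro sum.cong) auto
  then show ?thesis using assms finite_part_classes by simp
qed

text \<open>
  A block with trivial product travels past the other blocks to the block of its own class.
\<close>

lemma insert_power_block:
  assumes e: "\<And>g. g \<in> carrier G \<Longrightarrow> g [^] e = \<one>" and \<kappa>: "\<kappa> \<in> part_classes"
  shows "replicate e (rep \<kappa>) @ power_blocks e a \<asymp> power_blocks e (a(\<kappa> := Suc (a \<kappa>)))"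
proof -
  obtain ks ls where l: "class_list = ks @ \<kappa> # ls" using \<kappa> class_list(1) by (metis split_list)
  then have "\<kappa> \<notin> set ks" "\<kappa> \<notin> set ls" using class_list(2) by auto
  then have eq: "map (\<lambda>\<kappa>'. replicate (e * (a(\<kappa> := Suc (a \<kappa>))) \<kappa>') (rep \<kappa>')) ks
      = map (\<lambda>\<kappa>. replicate (e * a \<kappa>) (rep \<kappa>)) ks"
      "map (\<lambda>\<kappa>'. replicate (e * (a(\<kappa> := Suc (a \<kappa>))) \<kappa>') (rep \<kappa>')) ls
      = map (\<lambda>\<kappa>. replicate (e * a \<kappa>) (rep \<kappa>)) ls"
    by auto
  define us where "us = concat (map (\<lambda>\<kappa>. replicate (e * a \<kappa>) (rep \<kappa>)) ks)"
  define vs where "vs = replicate (e * a \<kappa>) (rep \<kappa>)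
    @ concat (map (\<lambda>\<kappa>. replicate (e * a \<kappa>) (rep \<kappa>)) ls)"
  have pb: "power_blocks e a = us @ vs" by (simp add: power_blocks_def us_def vs_def l)
  have pb': "power_blocks e (a(\<kappa> := Suc (a \<kappa>))) = us @ replicate e (rep \<kappa>) @ vs"
    unfolding power_blocks_def us_def vs_def l map_append list.map concat_append concat.simps eq
    by (simp add: replicate_add)
  have c: "set us \<subseteq> carrier G" "set vs \<subseteq> carrier G"
    using power_blocks_carrier[of e a] by (auto simp: pb)
  have "replicate e (rep \<kappa>) @ us \<asymp> us @ replicate e (rep \<kappa>)"
    using e rep_carrier[OF \<kappa>] c
    by (intro trivial_block_commute) (auto simp: prod_list_replicate simp del: foldr_replicate)
  then have "(replicate e (rep \<kappa>) @ us) @ vs \<asymp> (us @ replicate e (rep \<kappa>)) @ vs"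
    using c by (intro hurwitz_equiv_append_right)
  then show ?thesis by (simp add: pb pb')
qed

lemma hurwitz_equiv_in_parts:
  assumes "xs \<asymp> ys" "set xs \<subseteq> \<Union>D" shows "set ys \<subseteq> \<Union>D"
proof (rule ccontr)
  assume "\<not> set ys \<subseteq> \<Union>D"
  then have "length (filter (\<lambda>x. x \<in> \<Union>D) ys) < length ys"
    by (meson length_filter_less subsetI)
  also have "length ys = length (filter (\<lambda>x. x \<in> \<Union>D) xs)"
    using assms hurwitz_equiv_carrier[OF assms(1)] by (simp add: subset_iff)
  finally show False using hurwitz_equiv_count[OF assms(1) Union_closed] by simp
qed

text \<open>
  A tuple with more than \<open>e * card (carrier G)\<close> entries has an entry \<open>h\<close> that occurs more than
  \<open>e\<close> times.  Split off \<open>e\<close> of these copies; what remains still generates \<open>G\<close>, so the block can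
  be conjugated to the representative of the class of \<open>h\<close>, and the argument repeats on the
  remaining entries.
\<close>

lemma power_block_normal_form:
  fixes e :: nat
  assumes e: "0 < e" "\<And>g. g \<in> carrier G \<Longrightarrow> g [^] e = \<one>"
    and "set gs \<subseteq> \<Union>D" "generate G (set gs) = carrier G"
  shows "\<exists>a rest. gs \<asymp> power_blocks e a @ rest \<and> length rest \<le> e * card (carrier G)"
  using assms(3,4)
proof (induction "length gs" arbitrary: gs rule: less_induct)
  case less
  have gs: "set gs \<subseteq> carrier G" using less.prems Union_carrier by blast
  show ?case
  proof (cases "length gs \<le> e * card (carrier G)")
    case True
    have "power_blocks e (\<lambda>_. 0) = []" by (simp add: power_blocks_def)
    then have "gs \<asymp> power_blocks e (\<lambda>_. 0) @ gs" using gs by (simp add: hurwitz_equiv.refl)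
    then show ?thesis using True by blast
  next
    case False
    have "\<exists>h\<in>carrier G. e < count_list gs h"
    proof (rule ccontr)
      assume "\<not> ?thesis"
      then have "sum (count_list gs) (carrier G) \<le> (\<Sum>h\<in>carrier G. e)"
        by (intro sum_mono) (simp add: not_less)
      moreover have "sum (count_list gs) (carrier G) = length gs"
        using gs finite_carrier by (rule sum_count_set)
      ultimately show False using False by (simp add: mult.commute)
    qed
    then obtain h where h: "h \<in> carrier G" "e < count_list gs h" by blast
    then have "h \<in> set gs" by (metis count_notin not_less_zero)
    then obtain \<kappa> where \<kappa>: "\<kappa> \<in> part_classes" "h \<in> \<kappa>" using ex_class less.prems(1) by blast
    obtain rest where rest: "gs \<asymp> replicate e h @ rest" "generate G (set rest) = carrier G"
      using split_power_block[OF gs h(2)] less.prems(2) by auto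
    have sub: "set rest \<subseteq> \<Union>D" "set rest \<subseteq> carrier G"
      using hurwitz_equiv_in_parts[OF rest(1)] less.prems(1) hurwitz_equiv_carrier[OF rest(1)]
      by auto
    have "length gs = e + length rest" using hurwitz_equiv_carrier[OF rest(1)] by simp
    then have "length rest < length gs" using e(1) by simp
    then obtain a r where r: "rest \<asymp> power_blocks e a @ r" "length r \<le> e * card (carrier G)"
      using less.hyps sub(1) rest(2) by blast
    have cr: "set r \<subseteq> carrier G" using hurwitz_equiv_carrier[OF r(1)] by simp
    \<comment> \<open>the conjugation in \<open>conjugate_power_block\<close> is by the inverse, hence \<open>inv g\<close> below\<close>
    obtain g where g: "g \<in> carrier G" "rep \<kappa> = g \<otimes> h \<otimes> inv g"
      using conjugacy_class_orbit(1)[of \<kappa> h] \<kappa> rep_in[OF \<kappa>(1)] by (auto simp: part_classes_def)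
    have "replicate e h @ rest \<asymp> replicate e (rep \<kappa>) @ rest"
      using conjugate_power_block[OF e(2) sub(2), of "inv g" h] rest(2) g h(1) by simp
    also have "replicate e (rep \<kappa>) @ rest \<asymp> replicate e (rep \<kappa>) @ power_blocks e a @ r"
      using rep_carrier[OF \<kappa>(1)] by (intro hurwitz_equiv_append_left[OF r(1)]) auto
    also have "replicate e (rep \<kappa>) @ power_blocks e a @ r
        \<asymp> power_blocks e (a(\<kappa> := Suc (a \<kappa>))) @ r"
      using hurwitz_equiv_append_right[OF insert_power_block[OF e(2) \<kappa>(1)] cr] by simp
    finally have "gs \<asymp> power_blocks e (a(\<kappa> := Suc (a \<kappa>))) @ r"
      using hurwitz_equiv.trans rest(1) by blast
    then show ?thesis using r(2) by blast
  qed
qed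


section \<open>Counting components\<close>

lemma sum_part_counts:
  "(\<Sum>\<gamma>\<in>D. length (filter (\<lambda>x. x \<in> \<gamma>) gs)) = length (filter (\<lambda>x. x \<in> \<Union>D) gs)"
proof -
  let ?I = "\<lambda>\<gamma>. {i. i < length gs \<and> gs ! i \<in> \<gamma>}"
  have "card (\<Union>\<gamma>\<in>D. ?I \<gamma>) = (\<Sum>\<gamma>\<in>D. card (?I \<gamma>))"
    using finite_parts part_unique by (intro card_UN_disjoint) auto
  moreover have "(\<Union>\<gamma>\<in>D. ?I \<gamma>) = ?I (\<Union>D)" by auto
  ultimately show ?thesis by (simp only: length_filter_conv_card)
qed

text \<open>
  The length of the tuple is the sum of the prescribed numbers of entries in the disjoint sets
  \<open>\<gamma>\<close>, so there is no room for an entry outside \<open>\<Union>D\<close>.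
\<close>

lemma mem_hurwitz_tuples_iff:
  "gs \<in> hurwitz_tuples curve G D \<eta> \<longleftrightarrow>
    set gs \<subseteq> \<Union>D \<and> generate G (set gs) = carrier G \<and>
    (\<forall>\<gamma>\<in>D. length (filter (\<lambda>x. x \<in> \<gamma>) gs) = \<eta> \<gamma>) \<and>
    (curve = Projective_Line \<longrightarrow> foldr (\<otimes>) gs \<one> = \<one>)"
  (is "_ \<longleftrightarrow> ?rhs")
proof -
  have "length gs = sum \<eta> D \<longleftrightarrow> set gs \<subseteq> \<Union>D"
    if "\<forall>\<gamma>\<in>D. length (filter (\<lambda>x. x \<in> \<gamma>) gs) = \<eta> \<gamma>"
  proof -
    have "sum \<eta> D = (\<Sum>\<gamma>\<in>D. length (filter (\<lambda>x. x \<in> \<gamma>) gs))"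
      using that by simp
    then have eq: "sum \<eta> D = length (filter (\<lambda>x. x \<in> \<Union>D) gs)" by (simp only: sum_part_counts)
    show ?thesis
    proof
      assume len: "length gs = sum \<eta> D"
      show "set gs \<subseteq> \<Union>D"
      proof
        fix x assume "x \<in> set gs"
        then show "x \<in> \<Union>D"
          using length_filter_less[of x gs "\<lambda>x. x \<in> \<Union>D"] eq len by linarith
      qed
    next
      assume "set gs \<subseteq> \<Union>D"
      then have "filter (\<lambda>x. x \<in> \<Union>D) gs = gs" by (intro filter_True) blast
      then show "length gs = sum \<eta> D" using eq by simp
    qed
  qed
  moreover have "set gs \<subseteq> \<Union>D \<Longrightarrow> set gs \<subseteq> carrier G"
    using Union_carrier by (rule order_trans[rotated])
  ultimately show ?thesis
    unfolding hurwitz_tuples_def tuples_def mem_Collect_eq length_filter_conv_card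
    by blast
qed

lemma finite_hurwitz_tuples: "finite (hurwitz_tuples curve G D \<eta>)"
proof (rule finite_subset)
  show "hurwitz_tuples curve G D \<eta> \<subseteq> {xs. set xs \<subseteq> carrier G \<and> length xs = sum \<eta> D}"
    by (auto simp: hurwitz_tuples_def tuples_def)
  show "finite {xs. set xs \<subseteq> carrier G \<and> length xs = sum \<eta> D}"
    using finite_carrier by (rule finite_lists_length_eq)
qed

lemma pi0_CHur_eq:
  "pi0_CHur curve G D \<eta> = (\<lambda>gs. {hs. gs \<asymp> hs}) ` hurwitz_tuples curve G D \<eta>"
proof -
  have "hurwitz_tuples curve G D \<eta> \<subseteq> tuples G (sum \<eta> D)" by (auto simp: hurwitz_tuples_def)
  then have "orbit (braid_group (sum \<eta> D)) (braid_act G (sum \<eta> D)) gs = {hs. gs \<asymp> hs}"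
    if "gs \<in> hurwitz_tuples curve G D \<eta>" for gs
    using that by (intro braid_orbit_eq) blast
  then show ?thesis
    unfolding pi0_CHur_def Let_def orbits_def setcompr_eq_image by (intro image_cong) simp_all
qed

lemma finite_pi0_CHur: "finite (pi0_CHur curve G D \<eta>)"
  using finite_hurwitz_tuples by (simp add: pi0_CHur_eq)

lemma card_pi0_Projective_le:
  "card (pi0_CHur Projective_Line G D \<eta>) \<le> card (pi0_CHur Affine_Line G D \<eta>)"
proof (rule card_mono)
  have "hurwitz_tuples Projective_Line G D \<eta> \<subseteq> hurwitz_tuples Affine_Line G D \<eta>"
    by (auto simp: hurwitz_tuples_def)
  then show "pi0_CHur Projective_Line G D \<eta> \<subseteq> pi0_CHur Affine_Line G D \<eta>"
    by (auto simp: pi0_CHur_eq)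
qed (rule finite_pi0_CHur)

text \<open>
  In the normal form, the remainder \<open>rest\<close> is one of finitely many lists, whatever the length
  of the tuple.  Once it is fixed, the prescribed number of entries in each \<open>\<gamma>\<close> fixes the sum
  of the exponents \<open>a \<kappa>\<close> over the classes \<open>\<kappa>\<close> contained in \<open>\<gamma>\<close>.
\<close>

lemma card_pi0_CHur_le:
  fixes e :: nat
  assumes e: "0 < e" "\<And>g. g \<in> carrier G \<Longrightarrow> g [^] e = \<one>"
  shows "card (pi0_CHur Affine_Line G D \<eta>)
    \<le> card {xs. set xs \<subseteq> carrier G \<and> length xs \<le> e * card (carrier G)}
      * (sum \<eta> D + 1) ^ (card part_classes - card D)"
proof -
  let ?L = "{xs. set xs \<subseteq> carrier G \<and> length xs \<le> e * card (carrier G)}"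
  define s where "s rest \<gamma> = (\<eta> \<gamma> - length (filter (\<lambda>x. x \<in> \<gamma>) rest)) div e" for rest \<gamma>
  define V where "V rest = {a \<in> part_classes \<rightarrow>\<^sub>E {..sum \<eta> D}.
      \<forall>\<gamma>\<in>D. (\<Sum>\<kappa> | \<kappa> \<in> part_classes \<and> part \<kappa> = \<gamma>. a \<kappa>) = s rest \<gamma>}" for rest
  define orb where "orb rest a = {hs. power_blocks e a @ rest \<asymp> hs}" for rest a
  have finL: "finite ?L" using finite_carrier by (rule finite_lists_length_le)
  have finV: "finite (V rest)" for rest
    unfolding V_def using finite_part_classes
    by (intro finite_subset[OF _ finite_PiE[of part_classes "\<lambda>_. {..sum \<eta> D}"]]) auto
  have "pi0_CHur Affine_Line G D \<eta> \<subseteq> (\<Union>rest\<in>?L. orb rest ` V rest)"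
  proof
    fix c assume "c \<in> pi0_CHur Affine_Line G D \<eta>"
    then obtain gs where gs: "gs \<in> hurwitz_tuples Affine_Line G D \<eta>" and c: "c = {hs. gs \<asymp> hs}"
      by (auto simp: pi0_CHur_eq)
    obtain a rest where nf: "gs \<asymp> power_blocks e a @ rest" "length rest \<le> e * card (carrier G)"
      using power_block_normal_form[OF e] gs unfolding mem_hurwitz_tuples_iff by blast
    have rest: "rest \<in> ?L" using hurwitz_equiv_carrier[OF nf(1)] nf(2) by auto
    \<comment> \<open>only the values on \<open>part_classes\<close> matter; restricting makes the set of vectors finite\<close>
    define b where "b = restrict a part_classes"
    have ab: "power_blocks e a = power_blocks e b"
      by (rule power_blocks_cong) (simp add: b_def)
    have "gs \<asymp> power_blocks e b @ rest" using nf(1) ab by simp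
    then have "c = orb rest b"
      using hurwitz_class_eq_iff[of gs] hurwitz_equiv_carrier[OF nf(1)] by (simp add: c orb_def)
    moreover have "b \<in> V rest"
    proof -
      have "(\<Sum>\<kappa> | \<kappa> \<in> part_classes \<and> part \<kappa> = \<gamma>. b \<kappa>) = s rest \<gamma>" if \<gamma>: "\<gamma> \<in> D" for \<gamma>
      proof -
        have "\<eta> \<gamma> = length (filter (\<lambda>x. x \<in> \<gamma>) gs)"
          using gs \<gamma> by (simp add: mem_hurwitz_tuples_iff)
        also have "\<dots> = length (filter (\<lambda>x. x \<in> \<gamma>) (power_blocks e b @ rest))"
          using hurwitz_equiv_count[OF nf(1) part_closed[OF \<gamma>]] ab by simp
        also have "\<dots> = e * (\<Sum>\<kappa> | \<kappa> \<in> part_classes \<and> part \<kappa> = \<gamma>. b \<kappa>)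
            + length (filter (\<lambda>x. x \<in> \<gamma>) rest)"
          by (simp add: count_part_power_blocks[OF \<gamma>])
        finally show ?thesis using e(1) by (simp add: s_def)
      qed
      moreover have "b \<kappa> \<le> sum \<eta> D" if \<kappa>: "\<kappa> \<in> part_classes" for \<kappa>
      proof -
        have "b \<kappa> \<le> e * b \<kappa>" using e(1) by simp
        also have "\<dots> = length (filter (\<lambda>x. x \<in> \<kappa>) (power_blocks e b))"
          using count_class_power_blocks[OF \<kappa>] by simp
        also have "\<dots> \<le> length (power_blocks e b @ rest)" by (simp add: le_add1 order_trans[OF length_filter_le])
        also have "\<dots> = length gs" using hurwitz_equiv_carrier[OF nf(1)] ab by simp
        also have "\<dots> = sum \<eta> D" using gs by (auto simp: hurwitz_tuples_def tuples_def)
        finally show ?thesis .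
      qed
      moreover have "b \<in> extensional part_classes" by (simp add: b_def)
      ultimately show ?thesis by (simp add: V_def PiE_iff)
    qed
    ultimately show "c \<in> (\<Union>rest\<in>?L. orb rest ` V rest)" using rest by blast
  qed
  then have "card (pi0_CHur Affine_Line G D \<eta>) \<le> card (\<Union>rest\<in>?L. orb rest ` V rest)"
    using finL finV by (intro card_mono) auto
  also have "\<dots> \<le> (\<Sum>rest\<in>?L. card (orb rest ` V rest))" using finL by (rule card_UN_le)
  also have "\<dots> \<le> (\<Sum>rest\<in>?L. (sum \<eta> D + 1) ^ (card part_classes - card D))"
  proof (rule sum_mono)
    fix rest
    have "card (orb rest ` V rest) \<le> card (V rest)" using finV by (rule card_image_le)
    also have "\<dots> \<le> (sum \<eta> D + 1) ^ (card part_classes - card D)"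
      unfolding V_def using finite_part_classes part_image by (rule card_fibre_sums_le)
    finally show "card (orb rest ` V rest) \<le> (sum \<eta> D + 1) ^ (card part_classes - card D)" .
  qed
  finally show ?thesis by simp
qed

text \<open>
  The tuple that lists every element of \<open>\<Union>D\<close> exactly \<open>e\<close> times, followed by power blocks,
  generates \<open>G\<close>, and its product is trivial if the \<open>e\<close>-th power of every element is.
  The number of entries in a conjugacy class is a braid invariant, so different numbers of blocks
  give different components.
\<close>

lemma card_pi0_CHur_ge:
  fixes e :: nat
  assumes gen: "generate G (\<Union>D) = carrier G"
    and e: "0 < e" "\<And>g. curve = Projective_Line \<Longrightarrow> g \<in> carrier G \<Longrightarrow> g [^] e = \<one>"
    and \<eta>: "\<And>\<gamma>. \<gamma> \<in> D \<Longrightarrow> \<eta> \<gamma> = e * (card \<gamma> + s \<gamma>)"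
    and B: "\<And>\<gamma>. \<gamma> \<in> D \<Longrightarrow> card part_classes * B \<le> s \<gamma>"
  shows "(B + 1) ^ (card part_classes - card D) \<le> card (pi0_CHur curve G D \<eta>)"
proof -
  define V where "V = {a \<in> part_classes \<rightarrow>\<^sub>E {..sum s D}.
      \<forall>\<gamma>\<in>D. (\<Sum>\<kappa> | \<kappa> \<in> part_classes \<and> part \<kappa> = \<gamma>. a \<kappa>) = s \<gamma>}"
  obtain cs where cs: "set cs = \<Union>D" "distinct cs"
    using finite_distinct_list finite_subset[OF Union_carrier finite_carrier] by blast
  \<comment> \<open>the factor \<open>1\<close> gives the list the form required by \<open>prod_list_power_blocks\<close>\<close>
  define base where "base = concat (map (\<lambda>x. replicate (e * 1) x) cs)"
  define T where "T a = base @ power_blocks e a" for a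
  have set_base: "set base = \<Union>D" using e(1) cs(1) by (auto simp: base_def)
  then have set_T: "set (T a) = \<Union>D" for a
    using power_blocks_subset[of e a] by (simp add: T_def Un_absorb2)
  have base_count: "length (filter (\<lambda>x. x \<in> \<gamma>) base) = e * card \<gamma>" if \<gamma>: "\<gamma> \<in> D" for \<gamma>
  proof -
    have "length (filter (\<lambda>x. x \<in> \<gamma>) base) = (\<Sum>x\<in>\<Union>D. if x \<in> \<gamma> then e else 0)"
      unfolding base_def length_filter_replicates
      by (simp only: sum_list_distinct_conv_sum_set[OF cs(2)] cs(1) mult_1_right)
    also have "\<dots> = (\<Sum>x\<in>\<Union>D \<inter> \<gamma>. e)"
      using finite_subset[OF Union_carrier finite_carrier] by (simp only: sum.inter_restrict)
    also have "\<Union>D \<inter> \<gamma> = \<gamma>" using \<gamma> by blast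
    finally show ?thesis by (simp add: mult.commute)
  qed
  have T_in: "T a \<in> hurwitz_tuples curve G D \<eta>" if a: "a \<in> V" for a
  proof -
    have "length (filter (\<lambda>x. x \<in> \<gamma>) (T a)) = \<eta> \<gamma>" if \<gamma>: "\<gamma> \<in> D" for \<gamma>
      using a base_count[OF \<gamma>] \<gamma>
      by (simp add: T_def V_def count_part_power_blocks \<eta> distrib_left)
    moreover have "foldr (\<otimes>) (T a) \<one> = \<one>" if "curve = Projective_Line"
    proof -
      have "foldr (\<otimes>) base \<one> = \<one>"
        unfolding base_def using e(2)[OF that] cs Union_carrier by (intro prod_list_power_blocks) auto
      moreover have "foldr (\<otimes>) (power_blocks e a) \<one> = \<one>"
        unfolding power_blocks_def using e(2)[OF that] rep_carrier
        by (intro prod_list_power_blocks) (auto simp: class_list)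
      ultimately show ?thesis
        using set_base Union_carrier power_blocks_carrier
        by (simp add: T_def prod_list_append del: foldr_append)
    qed
    ultimately show ?thesis using gen by (simp add: mem_hurwitz_tuples_iff set_T)
  qed
  have "inj_on (\<lambda>a. {hs. T a \<asymp> hs}) V"
  proof (rule inj_onI)
    fix a b assume ab: "a \<in> V" "b \<in> V" and "{hs. T a \<asymp> hs} = {hs. T b \<asymp> hs}"
    then have eq: "T a \<asymp> T b" using hurwitz_class_eq_iff[of "T a" "T b"] Union_carrier by (simp add: set_T)
    show "a = b"
    proof (rule PiE_ext)
      show "a \<in> part_classes \<rightarrow>\<^sub>E {..sum s D}" "b \<in> part_classes \<rightarrow>\<^sub>E {..sum s D}"
        using ab by (simp_all add: V_def)
      fix \<kappa> assume \<kappa>: "\<kappa> \<in> part_classes"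
      then have "\<kappa> \<in> conjugacy_classes G" by (simp add: part_classes_def)
      from hurwitz_equiv_count[OF eq conjugacy_class_closed[OF this]]
      have "e * a \<kappa> = e * b \<kappa>" by (simp add: T_def count_class_power_blocks[OF \<kappa>])
      then show "a \<kappa> = b \<kappa>" using e(1) by simp
    qed
  qed
  moreover have "(\<lambda>a. {hs. T a \<asymp> hs}) ` V \<subseteq> pi0_CHur curve G D \<eta>"
    using T_in by (auto simp: pi0_CHur_eq)
  ultimately have "card V \<le> card (pi0_CHur curve G D \<eta>)"
    using finite_pi0_CHur by (rule card_inj_on_le)
  moreover have "(B + 1) ^ (card part_classes - card D) \<le> card V"
    unfolding V_def
  proof (rule card_fibre_sums_ge[OF finite_part_classes part_image B])
    show "s \<gamma> \<le> sum s D" if "\<gamma> \<in> D" for \<gamma> using that finite_parts by (intro member_le_sum) auto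
  qed
  ultimately show ?thesis by simp
qed

text \<open>
  Of the \<open>n * \<xi> \<gamma> \<ge> n\<close> runs of length \<open>e\<close> available in \<open>\<gamma>\<close>, at most \<open>card (carrier G)\<close> serve to
  list its elements.  The bound \<open>B = n div card (carrier G) - 1\<close> on the free entries leaves
  room for them, and \<open>n \<le> 2 * card (carrier G) * (B + 1)\<close>.
\<close>

lemma power_le_card_pi0_CHur:
  fixes e :: nat
  assumes gen: "generate G (\<Union>D) = carrier G"
    and e: "0 < e" "\<And>g. curve = Projective_Line \<Longrightarrow> g \<in> carrier G \<Longrightarrow> g [^] e = \<one>"
    and \<xi>: "\<And>\<gamma>. \<gamma> \<in> D \<Longrightarrow> 0 < \<xi> \<gamma>" and n: "card (carrier G) \<le> n"
  shows "n ^ (card part_classes - card D)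
    \<le> (2 * card (carrier G)) ^ (card part_classes - card D)
      * card (pi0_CHur curve G D (\<lambda>\<gamma>. n * e * \<xi> \<gamma>))"
proof -
  let ?g = "card (carrier G)" and ?d = "card part_classes - card D"
  define q where "q = n div ?g"
  have g: "0 < ?g" using finite_carrier by (auto simp: card_gt_0_iff)
  have "n = ?g * q + n mod ?g" by (simp add: q_def)
  moreover have "n mod ?g < ?g" using g by simp
  ultimately have "?g * q \<le> n" "n < ?g * q + ?g" by linarith+
  moreover have "0 < q" using g n by (simp add: q_def div_greater_zero_iff)
  ultimately have q: "0 < q" "?g * q \<le> n" "n < ?g * q + ?g" by simp_all
  have le: "card \<gamma> + card part_classes * (q - 1) \<le> n * \<xi> \<gamma>" if \<gamma>: "\<gamma> \<in> D" for \<gamma>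
  proof -
    have "card \<gamma> + card part_classes * (q - 1) \<le> ?g + ?g * (q - 1)"
      using card_mono[OF finite_carrier part_carrier[OF \<gamma>]] card_classes_le
      by (intro add_mono mult_right_mono) auto
    also have "\<dots> = ?g * q" using q(1) by (cases q) auto
    also have "\<dots> \<le> n * 1" using q(2) by simp
    also have "\<dots> \<le> n * \<xi> \<gamma>" using \<xi>[OF \<gamma>] by (intro mult_left_mono) auto
    finally show ?thesis .
  qed
  have "(q - 1 + 1) ^ ?d \<le> card (pi0_CHur curve G D (\<lambda>\<gamma>. n * e * \<xi> \<gamma>))"
  proof (rule card_pi0_CHur_ge[OF gen e])
    fix \<gamma> assume \<gamma>: "\<gamma> \<in> D"
    have "card \<gamma> + (n * \<xi> \<gamma> - card \<gamma>) = n * \<xi> \<gamma>" using le[OF \<gamma>] by simp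
    then show "n * e * \<xi> \<gamma> = e * (card \<gamma> + (n * \<xi> \<gamma> - card \<gamma>))"
      by (simp only: ac_simps)
    show "card part_classes * (q - 1) \<le> n * \<xi> \<gamma> - card \<gamma>" using le[OF \<gamma>] by simp
  qed
  then have "q ^ ?d \<le> card (pi0_CHur curve G D (\<lambda>\<gamma>. n * e * \<xi> \<gamma>))" using q(1) by simp
  moreover have "n ^ ?d \<le> (2 * ?g) ^ ?d * q ^ ?d"
  proof -
    have "?g * 1 \<le> ?g * q" using q(1) by (intro mult_left_mono) auto
    then have "n \<le> 2 * ?g * q" using q(3) by linarith
    then have "n ^ ?d \<le> (2 * ?g * q) ^ ?d" by (intro power_mono) simp_all
    then show ?thesis by (simp only: power_mult_distrib)
  qed
  ultimately show ?thesis by (rule order_trans[rotated, OF mult_le_mono2])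
qed

end

section \<open>Asymptotics\<close>

lemma (in group) group_exponent:
  assumes "finite (carrier G)"
  shows "0 < group_exponent G" "g \<in> carrier G \<Longrightarrow> g [^] group_exponent G = \<one>"
proof -
  have "0 < order G \<and> (\<forall>g\<in>carrier G. g [^] order G = \<one>)"
    using assms pow_order_eq_1 by (simp add: order_gt_0_iff_finite)
  then have "0 < group_exponent G \<and> (\<forall>g\<in>carrier G. g [^] group_exponent G = \<one>)"
    unfolding group_exponent_def by (rule LeastI)
  then show "0 < group_exponent G" "g \<in> carrier G \<Longrightarrow> g [^] group_exponent G = \<one>" by auto
qed

theorem theorem3p2:
  fixes G :: "('a, 'b) monoid_scheme" (structure)
    and D :: "'a set set"
    and \<xi> :: "'a set \<Rightarrow> nat"
  assumes "group G"
    and "finite (carrier G)"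
    and "carrier G \<noteq> {\<one>}"
    and "\<And>\<gamma>. \<gamma> \<in> D \<Longrightarrow> \<gamma> \<subseteq> carrier G"
    and "\<And>\<gamma>. \<gamma> \<in> D \<Longrightarrow> \<gamma> \<noteq> {}"
    and "pairwise disjnt D"
    and "generate G (\<Union>D) = carrier G"
    and "\<And>\<gamma>. \<gamma> \<in> D \<Longrightarrow> \<exists>K \<subseteq> conjugacy_classes G. \<gamma> = \<Union>K"
    and "\<And>\<gamma>. \<gamma> \<in> D \<Longrightarrow> \<xi> \<gamma> > 0"
  shows "((\<lambda>n. real (card (pi0_CHur Affine_Line G D (\<lambda>\<gamma>. n * \<xi> \<gamma>))))
          \<in> \<Theta>(\<lambda>n. real n powi splitting_number G D))
    \<and> ((\<lambda>n. real (card (pi0_CHur Projective_Line G D (\<lambda>\<gamma>. n * \<xi> \<gamma>))))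
          \<in> O(\<lambda>n. real n powi splitting_number G D))
    \<and> ((\<lambda>n. real n powi splitting_number G D)
          \<in> O(\<lambda>n. real (card (pi0_CHur Projective_Line G D
                            (\<lambda>\<gamma>. n * group_exponent G * \<xi> \<gamma>)))))"
proof -
  interpret group G by (rule assms(1))
  interpret class_partition G D
    by unfold_locales (use assms in auto)
  note e = group_exponent[OF finite_carrier]
  let ?d = "card part_classes - card D" and ?g = "card (carrier G)" and ?x = "sum \<xi> D"
  let ?c = "card {xs. set xs \<subseteq> carrier G \<and> length xs \<le> group_exponent G * ?g}"
  have powi: "real n powi splitting_number G D = real (n ^ ?d)" for n
    by (simp add: splitting_number_eq)
  have upper: "card (pi0_CHur Affine_Line G D (\<lambda>\<gamma>. n * \<xi> \<gamma>)) \<le> ?c * (?x + 1) ^ ?d * n ^ ?d"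
    if n: "1 \<le> n" for n
  proof -
    have "card (pi0_CHur Affine_Line G D (\<lambda>\<gamma>. n * \<xi> \<gamma>)) \<le> ?c * (n * ?x + 1) ^ ?d"
      using card_pi0_CHur_le[OF e, of "\<lambda>\<gamma>. n * \<xi> \<gamma>"] by (simp add: sum_distrib_left)
    also have "\<dots> \<le> ?c * ((?x + 1) * n) ^ ?d"
      using n by (intro mult_left_mono power_mono) (auto simp: algebra_simps)
    finally show ?thesis by (simp only: power_mult_distrib mult.assoc)
  qed
  have upper_affine: "(\<lambda>n. real (card (pi0_CHur Affine_Line G D (\<lambda>\<gamma>. n * \<xi> \<gamma>))))
      \<in> O(\<lambda>n. real n powi splitting_number G D)"
    unfolding powi
  proof (rule bigoI[where c = "real (?c * (?x + 1) ^ ?d)"], rule eventually_sequentiallyI[of 1])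
    fix n :: nat assume "1 \<le> n"
    from upper[OF this]
    show "norm (real (card (pi0_CHur Affine_Line G D (\<lambda>\<gamma>. n * \<xi> \<gamma>))))
        \<le> real (?c * (?x + 1) ^ ?d) * norm (real (n ^ ?d))"
      unfolding real_norm_def abs_of_nat by (simp only: of_nat_le_iff flip: of_nat_mult)
  qed
  have lower: "(\<lambda>n. real n powi splitting_number G D)
      \<in> O(\<lambda>n. real (card (pi0_CHur curve G D (\<lambda>\<gamma>. n * k * \<xi> \<gamma>))))"
    if "0 < k" "\<And>g. curve = Projective_Line \<Longrightarrow> g \<in> carrier G \<Longrightarrow> g [^] k = \<one>" for curve k
    unfolding powi
  proof (rule bigoI[where c = "real ((2 * ?g) ^ ?d)"], rule eventually_sequentiallyI[of ?g])
    fix n assume "?g \<le> n"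
    from power_le_card_pi0_CHur[OF assms(7) that assms(9) this]
    show "norm (real (n ^ ?d))
        \<le> real ((2 * ?g) ^ ?d) * norm (real (card (pi0_CHur curve G D (\<lambda>\<gamma>. n * k * \<xi> \<gamma>))))"
      unfolding real_norm_def abs_of_nat by (simp only: of_nat_le_iff flip: of_nat_mult)
  qed
  have "(\<lambda>n. real (card (pi0_CHur Projective_Line G D (\<lambda>\<gamma>. n * \<xi> \<gamma>))))
      \<in> O(\<lambda>n. real (card (pi0_CHur Affine_Line G D (\<lambda>\<gamma>. n * \<xi> \<gamma>))))"
    by (rule bigoI[where c = 1]) (simp add: card_pi0_Projective_le)
  then have "(\<lambda>n. real (card (pi0_CHur Projective_Line G D (\<lambda>\<gamma>. n * \<xi> \<gamma>))))
      \<in> O(\<lambda>n. real n powi splitting_number G D)"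
    using upper_affine by (rule landau_o.big_trans)
  moreover have "(\<lambda>n. real (card (pi0_CHur Affine_Line G D (\<lambda>\<gamma>. n * \<xi> \<gamma>))))
      \<in> \<Theta>(\<lambda>n. real n powi splitting_number G D)"
    using upper_affine lower[of 1 Affine_Line] by (intro bigthetaI) (simp_all add: bigomega_iff_bigo)
  ultimately show ?thesis using lower[OF e(1), of Projective_Line] e(2) by blast
qed

end
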